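(* Let $K$ be an algebraically closed field, let $G$ be a group, and let $K_\rho G$ be a twisted group algebra of $G$ over $K$ with factor system $\rho$. Then $K_\rho G$ is a $\xi N$-ring if and only if the following conditions both hold: (i) $G$ is an abelian torsion group; (ii) the factor system $\rho$ is symmetric.
   Context: Let $G$ be a group and $K$ a field. A twisted group algebra (twisted group ring) $K_\rho G$ of $G$ over $K$ is an associative $K$-algebra with a $K$-basis $\{u_g \mid g\in G\}$ indexed by $G$ (so scalars of $K$ commute with all $u_g$) and with multiplication determined by $u_g u_h=\rho(g,h)u_{gh}$ for $g,h\in G$, where $\rho=\{\rho(g,h)\mid g,h\in G\}$ is a family of nonzero elements of $K$ (the factor system) for which this multiplication is associative. The factor system is assumed normalized: $\rho(g,1)=\rho(1,g)=\rho(1,1)=1$ for all $g\in G$, so $u_1$ is the identity element. The factor system $\rho$ is called symmetric if for all $g,h\in G$ the condition $gh=hg$ implies $\rho(g,h)=\rho(h,g)$. A ring $R$ is called a $\xi N$-ring if for every $a\in R$ there exists $b\in R$ such that $a^2b-a$ is a central nilpotent element of $R$ (i.e. an element that is both central and nilpotent). *)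

theory Defs
  imports "HOL-Algebra.Algebra"
begin

definition torsion_group :: "('g, 'z) monoid_scheme \<Rightarrow> bool" where
  "torsion_group G \<longleftrightarrow>
     group G \<and> (\<forall>g \<in> carrier G. \<exists>n::nat. n > 0 \<and> g [^]\<^bsub>G\<^esub> n = \<one>\<^bsub>G\<^esub>)"

definition central_elem :: "('a, 'z) ring_scheme \<Rightarrow> 'a \<Rightarrow> bool" where
  "central_elem R c \<longleftrightarrow>
     c \<in> carrier R \<and> (\<forall>x \<in> carrier R. c \<otimes>\<^bsub>R\<^esub> x = x \<otimes>\<^bsub>R\<^esub> c)"

definition nilpotent_elem :: "('a, 'z) ring_scheme \<Rightarrow> 'a \<Rightarrow> bool" where
  "nilpotent_elem R c \<longleftrightarrow>
     c \<in> carrier R \<and> (\<exists>n::nat. n > 0 \<and> c [^]\<^bsub>R\<^esub> n = \<zero>\<^bsub>R\<^esub>)"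

definition xiN_ring :: "('a, 'z) ring_scheme \<Rightarrow> bool" where
  "xiN_ring R \<longleftrightarrow>
     ring R \<and>
     (\<forall>a \<in> carrier R. \<exists>b \<in> carrier R.
        central_elem R ((a [^]\<^bsub>R\<^esub> (2::nat)) \<otimes>\<^bsub>R\<^esub> b \<ominus>\<^bsub>R\<^esub> a) \<and>
        nilpotent_elem R ((a [^]\<^bsub>R\<^esub> (2::nat)) \<otimes>\<^bsub>R\<^esub> b \<ominus>\<^bsub>R\<^esub> a))"

definition symmetric_factor_system ::
  "('g, 'z) monoid_scheme \<Rightarrow> ('g \<Rightarrow> 'g \<Rightarrow> 'k) \<Rightarrow> bool" where
  "symmetric_factor_system G \<rho> \<longleftrightarrow>
     (\<forall>g \<in> carrier G. \<forall>h \<in> carrier G.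
        g \<otimes>\<^bsub>G\<^esub> h = h \<otimes>\<^bsub>G\<^esub> g \<longrightarrow> \<rho> g h = \<rho> h g)"

(* The family u, indexed by the set I, is a basis of the module M over R.  Independence
   is required of the family and not just of its range, so over a nonzero ring u is
   injective on I. *)
definition indexed_basis ::
  "('k, 'y) ring_scheme \<Rightarrow> ('k, 'a, 'z) module_scheme \<Rightarrow> 'i set \<Rightarrow> ('i \<Rightarrow> 'a) \<Rightarrow> bool" where
  "indexed_basis R M I u \<longleftrightarrow>
     u \<in> I \<rightarrow> carrier M \<and>
     (\<forall>x \<in> carrier M. \<exists>S c. finite S \<and> S \<subseteq> I \<and> c \<in> S \<rightarrow> carrier R \<and>
        x = (\<Oplus>\<^bsub>M\<^esub>i\<in>S. c i \<odot>\<^bsub>M\<^esub> u i)) \<and>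
     (\<forall>S c. finite S \<and> S \<subseteq> I \<and> c \<in> S \<rightarrow> carrier R \<and>
        (\<Oplus>\<^bsub>M\<^esub>i\<in>S. c i \<odot>\<^bsub>M\<^esub> u i) = \<zero>\<^bsub>M\<^esub> \<longrightarrow> (\<forall>i \<in> S. c i = \<zero>\<^bsub>R\<^esub>))"

(* A is the twisted group algebra of G over K with factor system \<rho> and basis u.
   The locale algebra of HOL-Algebra cannot be used here: it requires A to be commutative.
   Associativity of the product given by \<rho> is part of A being a ring. *)
locale twisted_group_algebra =
  K: field K + G: group G + module K A + A: ring A
  for K :: "('k, 'x) ring_scheme"
    and G :: "('g, 'y) monoid_scheme"
    and \<rho> :: "'g \<Rightarrow> 'g \<Rightarrow> 'k"
    and A :: "('k, 'a, 'z) module_scheme"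
    and u :: "'g \<Rightarrow> 'a" +
  assumes smult_mult_left:
      "\<lbrakk>k \<in> carrier K; x \<in> carrier A; y \<in> carrier A\<rbrakk> \<Longrightarrow>
        (k \<odot>\<^bsub>A\<^esub> x) \<otimes>\<^bsub>A\<^esub> y = k \<odot>\<^bsub>A\<^esub> (x \<otimes>\<^bsub>A\<^esub> y)"
    and smult_mult_right:
      "\<lbrakk>k \<in> carrier K; x \<in> carrier A; y \<in> carrier A\<rbrakk> \<Longrightarrow>
        x \<otimes>\<^bsub>A\<^esub> (k \<odot>\<^bsub>A\<^esub> y) = k \<odot>\<^bsub>A\<^esub> (x \<otimes>\<^bsub>A\<^esub> y)"
    and basis: "indexed_basis K A (carrier G) u"
    and factor_closed:
      "\<lbrakk>g \<in> carrier G; h \<in> carrier G\<rbrakk> \<Longrightarrow> \<rho> g h \<in> carrier K"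
    and factor_nonzero:
      "\<lbrakk>g \<in> carrier G; h \<in> carrier G\<rbrakk> \<Longrightarrow> \<rho> g h \<noteq> \<zero>\<^bsub>K\<^esub>"
    and factor_one_right: "g \<in> carrier G \<Longrightarrow> \<rho> g \<one>\<^bsub>G\<^esub> = \<one>\<^bsub>K\<^esub>"
    and factor_one_left: "g \<in> carrier G \<Longrightarrow> \<rho> \<one>\<^bsub>G\<^esub> g = \<one>\<^bsub>K\<^esub>"
    and basis_mult:
      "\<lbrakk>g \<in> carrier G; h \<in> carrier G\<rbrakk> \<Longrightarrow>
        u g \<otimes>\<^bsub>A\<^esub> u h = \<rho> g h \<odot>\<^bsub>A\<^esub> u (g \<otimes>\<^bsub>G\<^esub> h)"

end

theory Submission
  imports Defs
begin

text \<open>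
Let \<open>A\<close> be the twisted group algebra. The link between both directions is the following use of
algebraic closedness. If \<open>g\<close> has finite order, then \<open>u g\<close> satisfies a polynomial
\<open>X^n - k\<close>, which splits into linear factors over \<open>K\<close>. Provided that the idempotents of
\<open>A\<close> are central, the identity decomposes into orthogonal idempotents \<open>e\<close> such that
\<open>(u g - l) e\<close> is nilpotent for some scalar \<open>l\<close>. The lemma
\<open>splits_over_if_linear_factors_zero\<close> proves this decomposition in an arbitrary ring, in the form of
an induction principle (\<open>splits_over\<close>): a property of idempotents that is additive over orthogonal
sums holds for all idempotents as soon as it holds for those on which the element is a scalar up to a
nilpotent.

Suppose that \<open>A\<close> is a \<open>\<xi>N\<close>-ring. Its nilpotent elements are central
(\<open>nilpotents_central\<close>), hence so are its idempotents (\<open>idempotents_central\<close>). If \<open>g\<close> had infinite order,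
then \<open>1 - u g\<close> would be left cancellable, because a finitely supported coefficient function cannot
be nonvanishing along an infinite orbit of \<open>g\<close>. In a \<open>\<xi>N\<close>-ring a left cancellable element
is right invertible (\<open>right_invertible_if_left_cancellable\<close>), but the same look at supports shows that
\<open>1 - u g\<close> is not. So \<open>G\<close> is torsion. By the decomposition, every \<open>u g\<close> is a sum of
elements \<open>l e + z\<close> with \<open>l\<close> a scalar, \<open>e\<close> idempotent and \<open>z\<close> nilpotent, all of them
central, so \<open>u g\<close> is central. Comparing coefficients in \<open>u g u h = u h u g\<close> yields that \<open>G\<close> is
abelian and \<open>\<rho>\<close> symmetric.

Conversely, under the two conditions \<open>A\<close> is commutative. The elements that admit a
decomposition as above contain all \<open>u g\<close>, and in a commutative ring they are closed under sums and
scalar multiples (common refinement of the idempotents), so every \<open>a\<close> in \<open>A\<close> admits one. On an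
idempotent where \<open>a\<close> is \<open>l\<close> up to a nilpotent, take \<open>b = 0\<close> if \<open>l = 0\<close> and
\<open>b = 1/l\<close> otherwise; these choices glue to a \<open>b\<close> with \<open>a^2 b - a\<close> nilpotent.
\<close>

section \<open>Central, nilpotent and idempotent elements\<close>

context ring
begin

lemma central_elem_closed: "central_elem R c \<Longrightarrow> c \<in> carrier R"
  by (simp add: central_elem_def)

lemma central_elem_commutes:
  "\<lbrakk>central_elem R c; x \<in> carrier R\<rbrakk> \<Longrightarrow> c \<otimes> x = x \<otimes> c"
  by (simp add: central_elem_def)

lemma central_elem_add:
  assumes x: "central_elem R x" and y: "central_elem R y"
  shows "central_elem R (x \<oplus> y)"
  unfolding central_elem_def
proof (intro conjI ballI)
  note c = central_elem_closed[OF x] central_elem_closed[OF y]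
  show "x \<oplus> y \<in> carrier R" using c by simp
  fix z assume z: "z \<in> carrier R"
  show "(x \<oplus> y) \<otimes> z = z \<otimes> (x \<oplus> y)"
    using c z by (simp add: l_distr r_distr central_elem_commutes[OF x z] central_elem_commutes[OF y z])
qed

lemma central_elem_mult:
  assumes x: "central_elem R x" and y: "central_elem R y"
  shows "central_elem R (x \<otimes> y)"
  unfolding central_elem_def
proof (intro conjI ballI)
  note c = central_elem_closed[OF x] central_elem_closed[OF y]
  show "x \<otimes> y \<in> carrier R" using c by simp
  fix z assume z: "z \<in> carrier R"
  show "x \<otimes> y \<otimes> z = z \<otimes> (x \<otimes> y)"
    using c z central_elem_commutes[OF x z] central_elem_commutes[OF y z] by (metis m_assoc)
qed

lemma central_elem_uminus:
  assumes x: "central_elem R x"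
  shows "central_elem R (\<ominus> x)"
  unfolding central_elem_def
proof (intro conjI ballI)
  note c = central_elem_closed[OF x]
  show "\<ominus> x \<in> carrier R" using c by simp
  fix z assume z: "z \<in> carrier R"
  show "\<ominus> x \<otimes> z = z \<otimes> (\<ominus> x)"
    using c z by (simp add: l_minus r_minus central_elem_commutes[OF x z])
qed

lemma central_elem_minus:
  assumes "central_elem R x" "central_elem R y"
  shows "central_elem R (x \<ominus> y)"
  using assms by (simp add: minus_eq central_elem_add central_elem_uminus)

lemma central_elem_zero: "central_elem R \<zero>"
  by (auto simp: central_elem_def)

text \<open>
Induction on the nilpotency index \<open>n\<close>: the square \<open>a^2\<close> has index at most \<open>(n + 1) div 2\<close>, so it is
central. Hence \<open>a^2 b\<close> has the same bound on its index and is central too, and \<open>a\<close> differs from it by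
the central element that the \<open>\<xi>N\<close>-condition provides.
\<close>

lemma nilpotents_central:
  assumes xi: "xiN_ring R" and a: "a \<in> carrier R" and n: "a [^] (n::nat) = \<zero>"
  shows "central_elem R a"
  using a n
proof (induction n arbitrary: a rule: less_induct)
  case (less n)
  show ?case
  proof (cases "n \<le> 1")
    case True
    then consider "n = 0" | "n = 1" by linarith
    then show ?thesis
    proof cases
      case 1
      then have "\<one> = \<zero>" using less.prems by simp
      then have "a = \<zero>" using less.prems one_zeroD by blast
      then show ?thesis using central_elem_zero by simp
    next
      case 2
      then show ?thesis using less.prems central_elem_zero by simp
    qed
  next
    case False
    define m where "m = (n + 1) div 2"
    have m: "m < n" "n \<le> 2 * m" using False by (auto simp: m_def)
    have "(a [^] (2::nat)) [^] m = a [^] n \<otimes> a [^] (2 * m - n)"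
      using nat_pow_mult[OF less.prems(1), of n "2 * m - n"] nat_pow_pow[OF less.prems(1), of 2 m] m
      by simp
    then have sq0: "(a [^] (2::nat)) [^] m = \<zero>" using less.prems by simp
    have sq: "central_elem R (a [^] (2::nat))" using less.IH[OF m(1)] sq0 less.prems by simp
    obtain b where b: "b \<in> carrier R" and z: "central_elem R (a [^] (2::nat) \<otimes> b \<ominus> a)"
      using xi less.prems unfolding xiN_ring_def by blast
    have "a [^] (2::nat) \<otimes> b = b \<otimes> a [^] (2::nat)" using sq b by (simp add: central_elem_def)
    then have "(a [^] (2::nat) \<otimes> b) [^] m = (a [^] (2::nat)) [^] m \<otimes> b [^] m"
      using less.prems b by (intro pow_mult_distrib) auto
    then have "(a [^] (2::nat) \<otimes> b) [^] m = \<zero>" using sq0 b by simp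
    then have "central_elem R (a [^] (2::nat) \<otimes> b)" using less.IH[OF m(1)] less.prems b by simp
    then have c: "central_elem R (a [^] (2::nat) \<otimes> b \<ominus> (a [^] (2::nat) \<otimes> b \<ominus> a))"
      using z central_elem_minus by blast
    have "a [^] (2::nat) \<in> carrier R" using less.prems by simp
    then have "a [^] (2::nat) \<otimes> b \<ominus> (a [^] (2::nat) \<otimes> b \<ominus> a) = a"
      using less.prems(1) b by algebra
    then show ?thesis using c by simp
  qed
qed

text \<open>The inverse is the geometric sum \<open>1 + w + w^2 + \<dots>\<close>, built up term by term.\<close>

lemma one_minus_nilpotent_right_invertible:
  assumes w: "w \<in> carrier R" "w [^] (n::nat) = \<zero>"
  shows "\<exists>v\<in>carrier R. (\<one> \<ominus> w) \<otimes> v = \<one>"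
proof -
  have "\<exists>v\<in>carrier R. (\<one> \<ominus> w) \<otimes> v = \<one> \<ominus> w [^] k" for k :: nat
  proof (induction k)
    case 0
    then show ?case using w by (auto intro!: bexI[of _ \<zero>] simp: minus_eq r_neg)
  next
    case (Suc k)
    then obtain v where v: "v \<in> carrier R" "(\<one> \<ominus> w) \<otimes> v = \<one> \<ominus> w [^] k" by blast
    have c: "w [^] k \<in> carrier R" "w \<otimes> w [^] k \<in> carrier R" using w by auto
    have "(\<one> \<ominus> w) \<otimes> (v \<oplus> w [^] k) = (\<one> \<ominus> w [^] k) \<oplus> (w [^] k \<ominus> w \<otimes> w [^] k)"
      using v w c by (simp add: r_distr minus_eq[of \<one> w] l_distr l_minus) (simp add: minus_eq)
    also have "\<dots> = \<one> \<ominus> w \<otimes> w [^] k" using c by algebra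
    finally show ?case using v c nat_pow_Suc2[OF w(1), of k] by (intro bexI[of _ "v \<oplus> w [^] k"]) auto
  qed
  from this[of n] show ?thesis using w by (simp add: minus_eq)
qed

text \<open>
Write \<open>z = a^2 b - a = a (a b - 1)\<close>. As \<open>z\<close> commutes with \<open>a\<close>, cancelling \<open>a\<close> twice gives
\<open>a b = b a\<close>. Then \<open>a\<close> commutes with \<open>a b - 1\<close>, so \<open>z^n = a^n (a b - 1)^n\<close>; cancelling again makes
\<open>a b - 1\<close> nilpotent and \<open>a b\<close> right invertible.
\<close>

lemma right_invertible_if_left_cancellable:
  assumes xi: "xiN_ring R" and a: "a \<in> carrier R"
    and cancel: "\<And>x. \<lbrakk>x \<in> carrier R; a \<otimes> x = \<zero>\<rbrakk> \<Longrightarrow> x = \<zero>"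
  shows "\<exists>b\<in>carrier R. a \<otimes> b = \<one>"
proof -
  obtain b where b: "b \<in> carrier R" and central: "central_elem R (a [^] (2::nat) \<otimes> b \<ominus> a)"
    and nil: "nilpotent_elem R (a [^] (2::nat) \<otimes> b \<ominus> a)"
    using xi a unfolding xiN_ring_def by blast
  define z where "z = a [^] (2::nat) \<otimes> b \<ominus> a"
  have z: "z = a \<otimes> (a \<otimes> b) \<ominus> a"
    using a b by (simp add: z_def numeral_2_eq_2 m_assoc)
  have zc: "z \<in> carrier R" using z a b by simp
  have "a \<otimes> (a \<otimes> (a \<otimes> b \<ominus> b \<otimes> a)) = a \<otimes> z \<ominus> z \<otimes> a" unfolding z using a b by algebra
  also have "\<dots> = \<zero>"
    using central_elem_commutes[OF central[folded z_def] a] a zc by (simp add: minus_eq r_neg)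
  finally have "a \<otimes> b \<ominus> b \<otimes> a = \<zero>" using cancel a b by simp
  then have ab: "a \<otimes> b = b \<otimes> a" using a b by simp
  define w where "w = \<one> \<ominus> a \<otimes> b"
  have w: "w \<in> carrier R" using a b by (simp add: w_def)
  have "a \<otimes> w = a \<ominus> a \<otimes> (a \<otimes> b)"
    unfolding w_def using a b by (simp add: minus_eq r_distr r_minus)
  moreover have "w \<otimes> a = a \<ominus> a \<otimes> (b \<otimes> a)"
    unfolding w_def using a b by (simp add: minus_eq l_distr l_minus m_assoc)
  ultimately have aw: "a \<otimes> w = w \<otimes> a" using ab by simp
  obtain n :: nat where n: "z [^] n = \<zero>" using nil unfolding nilpotent_elem_def z_def by blast
  have "z = a \<otimes> (\<ominus> w)"
    unfolding z w_def using a b by (simp add: minus_eq r_distr r_minus minus_add a_comm)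
  moreover have "a \<otimes> (\<ominus> w) = (\<ominus> w) \<otimes> a" using aw a w by (simp add: l_minus r_minus)
  ultimately have "z [^] n = a [^] n \<otimes> (\<ominus> w) [^] n"
    using pow_mult_distrib[of a "\<ominus> w" n] a a_inv_closed[OF w] by metis
  moreover have "x = \<zero>" if "x \<in> carrier R" "a [^] k \<otimes> x = \<zero>" for x and k :: nat
    using that
  proof (induction k arbitrary: x)
    case (Suc k)
    then have "a [^] k \<otimes> (a \<otimes> x) = \<zero>" using a by (simp add: m_assoc)
    then show ?case using Suc a cancel by blast
  qed simp
  ultimately have mw: "(\<ominus> w) [^] n = \<zero>" using n w by simp
  have "w = \<ominus> \<one> \<otimes> (\<ominus> w)" "\<ominus> \<one> \<otimes> (\<ominus> w) = (\<ominus> w) \<otimes> (\<ominus> \<one>)"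
    using w by (simp_all add: l_minus r_minus)
  then have "w [^] n = (\<ominus> \<one>) [^] n \<otimes> (\<ominus> w) [^] n"
    using w by (metis pow_mult_distrib a_inv_closed one_closed)
  then have "w [^] n = \<zero>" using mw by simp
  then obtain v where v: "v \<in> carrier R" "(\<one> \<ominus> w) \<otimes> v = \<one>"
    using one_minus_nilpotent_right_invertible w by blast
  have "\<one> \<ominus> w = a \<otimes> b" unfolding w_def using a b by algebra
  then have "a \<otimes> (b \<otimes> v) = \<one>" using v a b by (simp add: m_assoc)
  then show ?thesis using b v by blast
qed

definition idempotent :: "'a \<Rightarrow> bool" where
  "idempotent e \<longleftrightarrow> e \<in> carrier R \<and> e \<otimes> e = e"

text \<open>Both \<open>e x (1 - e)\<close> and \<open>(1 - e) x e\<close> square to zero. Being central, they commute with \<open>e\<close>, which forces them to vanish.\<close>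

lemma idempotents_central:
  assumes nil: "\<And>x. \<lbrakk>x \<in> carrier R; x \<otimes> x = \<zero>\<rbrakk> \<Longrightarrow> central_elem R x" and e: "idempotent e"
  shows "central_elem R e"
proof -
  have ec: "e \<in> carrier R" and ee: "e \<otimes> e = e" using e by (auto simp: idempotent_def)
  have ee': "e \<otimes> (e \<otimes> z) = e \<otimes> z" if "z \<in> carrier R" for z
    using ec ee that by (metis m_assoc)
  have "e \<otimes> x = x \<otimes> e" if x: "x \<in> carrier R" for x
  proof -
    let ?c = "e \<otimes> x \<ominus> e \<otimes> x \<otimes> e" and ?d = "x \<otimes> e \<ominus> e \<otimes> x \<otimes> e"
    have "?c \<otimes> ?c = \<zero>" using ec x ee ee'
      by (simp add: minus_eq l_distr r_distr l_minus r_minus m_assoc r_neg)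
    then have "central_elem R ?c" using nil ec x by simp
    then have "e \<otimes> ?c = ?c \<otimes> e" using ec by (simp add: central_elem_def)
    then have c: "?c = \<zero>" using ec x ee ee'
      by (simp add: minus_eq l_distr r_distr l_minus r_minus m_assoc r_neg)
    have "?d \<otimes> ?d = \<zero>" using ec x ee ee'
      by (simp add: minus_eq l_distr r_distr l_minus r_minus m_assoc r_neg)
    then have "central_elem R ?d" using nil ec x by simp
    then have "e \<otimes> ?d = ?d \<otimes> e" using ec by (simp add: central_elem_def)
    then have d: "?d = \<zero>" using ec x ee ee'
      by (simp add: minus_eq l_distr r_distr l_minus r_minus m_assoc r_neg)
    show ?thesis using c d ec x by (metis m_closed r_right_minus_eq)
  qed
  then show ?thesis using ec by (simp add: central_elem_def)
qed

section \<open>Splitting an element along idempotents\<close>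

text \<open>
Says that \<open>1\<close> is a finite sum of orthogonal idempotents \<open>f\<close> on each of which \<open>a\<close> is an element
of \<open>F\<close> up to a nilpotent. Phrasing it as an induction principle over idempotents avoids carrying
families of idempotents around: refining two decompositions becomes a nested use of the principle.
\<close>

definition splits_over :: "'a set \<Rightarrow> 'a \<Rightarrow> bool" where
  "splits_over F a \<longleftrightarrow>
     (\<forall>Q. (\<forall>e e'. idempotent e \<and> idempotent e' \<and> e \<otimes> e' = \<zero> \<and> Q e \<and> Q e' \<longrightarrow> Q (e \<oplus> e')) \<longrightarrow>
          (\<forall>f. idempotent f \<and> (\<exists>l\<in>F. nilpotent_elem R ((a \<ominus> l) \<otimes> f)) \<longrightarrow> Q f) \<longrightarrow>
          (\<forall>f. idempotent f \<longrightarrow> Q f))"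

lemma splits_over_cases:
  assumes "splits_over F a" "idempotent f"
    and "\<And>e e'. \<lbrakk>idempotent e; idempotent e'; e \<otimes> e' = \<zero>; Q e; Q e'\<rbrakk> \<Longrightarrow> Q (e \<oplus> e')"
    and "\<And>f l. \<lbrakk>idempotent f; l \<in> F; nilpotent_elem R ((a \<ominus> l) \<otimes> f)\<rbrakk> \<Longrightarrow> Q f"
  shows "Q f"
  using assms unfolding splits_over_def by blast

primrec linear_factors :: "'a \<Rightarrow> 'a list \<Rightarrow> 'a" where
  "linear_factors a [] = \<one>"
| "linear_factors a (l # ls) = (a \<ominus> l) \<otimes> linear_factors a ls"

lemma linear_factors_closed [simp]:
  "\<lbrakk>a \<in> carrier R; set ls \<subseteq> carrier R\<rbrakk> \<Longrightarrow> linear_factors a ls \<in> carrier R"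
  by (induction ls) auto

lemma linear_factors_filter:
  assumes a: "a \<in> carrier R" and l: "central_elem R l" and ls: "\<forall>m\<in>set ls. central_elem R m"
  shows "linear_factors a ls =
    (a \<ominus> l) [^] count_list ls l \<otimes> linear_factors a (filter (\<lambda>m. m \<noteq> l) ls)"
  using ls
proof (induction ls)
  case Nil
  then show ?case by simp
next
  case (Cons m ms)
  let ?y = "a \<ominus> l" and ?k = "count_list ms l"
  let ?P = "linear_factors a (filter (\<lambda>m. m \<noteq> l) ms)"
  have lc: "l \<in> carrier R" and mc: "m \<in> carrier R"
    using l Cons.prems by (auto intro: central_elem_closed)
  have y: "?y \<in> carrier R" using a lc by simp
  have P: "?P \<in> carrier R"
    using a Cons.prems by (auto intro!: linear_factors_closed intro: central_elem_closed)
  have IH: "linear_factors a ms = ?y [^] ?k \<otimes> ?P" using Cons by simp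
  have la: "l \<otimes> a = a \<otimes> l" and lm: "l \<otimes> m = m \<otimes> l" and ma: "m \<otimes> a = a \<otimes> m"
    using l Cons.prems a mc by (auto intro: central_elem_commutes)
  have "?y \<otimes> (a \<ominus> m) = a \<otimes> a \<ominus> a \<otimes> m \<ominus> l \<otimes> a \<oplus> l \<otimes> m" using a lc mc by algebra
  also have "\<dots> = a \<otimes> a \<ominus> m \<otimes> a \<ominus> a \<otimes> l \<oplus> m \<otimes> l" by (simp only: la lm ma)
  also have "\<dots> = (a \<ominus> m) \<otimes> ?y" using a lc mc by algebra
  finally have comm: "?y \<otimes> (a \<ominus> m) = (a \<ominus> m) \<otimes> ?y" .
  have pc: "(a \<ominus> m) \<otimes> ?y [^] ?k = ?y [^] ?k \<otimes> (a \<ominus> m)"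
    using group_commutes_pow[OF comm y, of ?k] a mc by simp
  show ?case
  proof (cases "m = l")
    case True
    then show ?thesis using IH pc y P
      by (simp add: m_assoc[symmetric])
  next
    case False
    then show ?thesis using IH pc y P a mc
      by (simp add: m_assoc[symmetric])
  qed
qed

text \<open>
A product of factors \<open>a - m\<close> with all \<open>m \<noteq> l\<close> is congruent modulo \<open>a - l\<close> to the product of
the units \<open>l - m\<close>. This replaces the coprimality of \<open>X - l\<close> and the remaining factors.
\<close>

lemma linear_factors_remainder:
  assumes a: "a \<in> carrier R"
    and central: "\<And>l. l \<in> F \<Longrightarrow> central_elem R l"
    and unit: "\<And>l m. \<lbrakk>l \<in> F; m \<in> F; l \<noteq> m\<rbrakk> \<Longrightarrow> l \<ominus> m \<in> Units R"
    and l: "l \<in> F" and ls: "set ls \<subseteq> F" "l \<notin> set ls"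
  shows "\<exists>r c. r \<in> carrier R \<and> r \<otimes> (a \<ominus> l) = (a \<ominus> l) \<otimes> r \<and> c \<in> Units R \<and> central_elem R c \<and>
           linear_factors a ls = (a \<ominus> l) \<otimes> r \<oplus> c"
  using ls
proof (induction ls)
  case Nil
  show ?case
    by (rule exI[of _ \<zero>], rule exI[of _ \<one>])
       (use a l central in \<open>auto simp: central_elem_def\<close>)
next
  case (Cons m ms)
  let ?y = "a \<ominus> l" and ?d = "l \<ominus> m"
  obtain r c where r: "r \<in> carrier R" "r \<otimes> ?y = ?y \<otimes> r" and c: "c \<in> Units R" "central_elem R c"
    and IH: "linear_factors a ms = ?y \<otimes> r \<oplus> c"
    using Cons by auto
  have lc: "l \<in> carrier R" and mc: "m \<in> carrier R"
    using l Cons.prems central by (auto intro: central_elem_closed)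
  have y: "?y \<in> carrier R" using a lc by simp
  have d: "?d \<in> Units R" "central_elem R ?d" "?d \<in> carrier R"
    using Cons.prems l central unit lc mc by (auto intro: central_elem_minus)
  have cc: "c \<in> carrier R" using c by auto
  have am: "a \<ominus> m = ?y \<oplus> ?d" using a lc mc by algebra
  have dy: "?d \<otimes> ?y = ?y \<otimes> ?d" and cy: "c \<otimes> ?y = ?y \<otimes> c" and rd: "?d \<otimes> r = r \<otimes> ?d"
    using d c y r by (auto intro: central_elem_commutes)
  have "linear_factors a (m # ms) = (?y \<oplus> ?d) \<otimes> (?y \<otimes> r \<oplus> c)" using IH am by simp
  also have "\<dots> = ?y \<otimes> (?y \<otimes> r \<oplus> c \<oplus> ?d \<otimes> r) \<oplus> ?d \<otimes> c"
    using y d cc r(1) dy by (simp add: l_distr r_distr m_assoc[symmetric] a_ac)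
  finally have eq: "linear_factors a (m # ms) = ?y \<otimes> (?y \<otimes> r \<oplus> c \<oplus> ?d \<otimes> r) \<oplus> ?d \<otimes> c" .
  have "?d \<otimes> r \<otimes> ?y = ?y \<otimes> (?d \<otimes> r)"
    using dy r d(3) y by (metis m_assoc)
  then have "(?y \<otimes> r \<oplus> c \<oplus> ?d \<otimes> r) \<otimes> ?y = ?y \<otimes> (?y \<otimes> r \<oplus> c \<oplus> ?d \<otimes> r)"
    using y d(3) cc r cy by (simp add: l_distr r_distr m_assoc)
  moreover have "?y \<otimes> r \<oplus> c \<oplus> ?d \<otimes> r \<in> carrier R" using y r(1) cc d(3) by simp
  moreover have "?d \<otimes> c \<in> Units R" using d c by simp
  moreover have "central_elem R (?d \<otimes> c)" using d c central_elem_mult by blast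
  ultimately show ?case using eq by blast
qed

text \<open>
Induction on the number of factors. Collect the factors equal to
\<open>y = a - l\<close>, so that \<open>y^k P f = 0\<close>, where \<open>P\<close> is the product of the others. Up to a unit \<open>c\<close>,
the element \<open>P\<close> is \<open>1 - t\<close> with \<open>t\<close> a multiple of \<open>y\<close>. Then \<open>t^k f = t^(k+1) f\<close>, so
\<open>e = t^k f\<close> is an idempotent. On \<open>e\<close> the product \<open>P\<close> vanishes and the induction hypothesis applies;
on \<open>f - e\<close> the power \<open>y^k\<close> vanishes, so \<open>a\<close> is \<open>l\<close> up to a nilpotent.
\<close>

lemma splits_over_if_linear_factors_zero:
  assumes idc: "\<And>e. idempotent e \<Longrightarrow> central_elem R e"
    and a: "a \<in> carrier R" and "F \<noteq> {}"
    and central: "\<And>l. l \<in> F \<Longrightarrow> central_elem R l"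
    and unit: "\<And>l m. \<lbrakk>l \<in> F; m \<in> F; l \<noteq> m\<rbrakk> \<Longrightarrow> l \<ominus> m \<in> Units R"
    and L: "set L \<subseteq> F" "linear_factors a L = \<zero>"
  shows "splits_over F a"
  unfolding splits_over_def
proof (intro allI impI)
  fix Q f
  assume add: "\<forall>e e'. idempotent e \<and> idempotent e' \<and> e \<otimes> e' = \<zero> \<and> Q e \<and> Q e' \<longrightarrow> Q (e \<oplus> e')"
    and base: "\<forall>f. idempotent f \<and> (\<exists>l\<in>F. nilpotent_elem R ((a \<ominus> l) \<otimes> f)) \<longrightarrow> Q f"
    and f: "idempotent f"
  have F: "x \<in> carrier R" if "x \<in> F" for x using central[OF that] by (simp add: central_elem_def)
  have "Q f" if "set L \<subseteq> F" "linear_factors a L \<otimes> f = \<zero>" "idempotent f" for L f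
    using that
  proof (induction "length L" arbitrary: L f rule: less_induct)
    case less
    have fc: "f \<in> carrier R" and ff: "f \<otimes> f = f" using less.prems by (auto simp: idempotent_def)
    have fcomm: "f \<otimes> x = x \<otimes> f" if "x \<in> carrier R" for x
      using idc[OF less.prems(3)] that by (simp add: central_elem_def)
    show ?case
    proof (cases L)
      case Nil
      obtain l where l: "l \<in> F" using \<open>F \<noteq> {}\<close> by blast
      have "f = \<zero>" using less.prems fc Nil by simp
      then have "nilpotent_elem R ((a \<ominus> l) \<otimes> f)"
        using a F[OF l] by (auto simp: nilpotent_elem_def intro!: exI[of _ 1])
      then show ?thesis using base l less.prems by blast
    next
      case (Cons l ls)
      define L' where "L' = filter (\<lambda>m. m \<noteq> l) L"
      define k where "k = count_list L l"
      define y where "y = a \<ominus> l"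
      define P where "P = linear_factors a L'"
      have l: "l \<in> F" and LF: "set L \<subseteq> F" using less.prems Cons by auto
      have k: "k > 0" using Cons by (simp add: k_def)
      have short: "length L' < length L" unfolding L'_def using Cons by (simp add: le_imp_less_Suc)
      have y: "y \<in> carrier R" using a F[OF l] by (simp add: y_def)
      have yP: "linear_factors a L = y [^] k \<otimes> P"
        unfolding y_def k_def P_def L'_def using LF central l by (intro linear_factors_filter a) auto
      obtain r c where r: "r \<in> carrier R" "r \<otimes> y = y \<otimes> r" and c: "c \<in> Units R" "central_elem R c"
        and P: "P = y \<otimes> r \<oplus> c"
        using linear_factors_remainder[OF a central unit l, of L'] LF
        unfolding P_def y_def L'_def by auto
      define d where "d = inv c"
      have cc: "c \<in> carrier R" and d: "d \<in> carrier R" "c \<otimes> d = \<one>" "d \<otimes> c = \<one>"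
        using c by (auto simp: d_def)
      have dcomm: "d \<otimes> x = x \<otimes> d" if x: "x \<in> carrier R" for x
      proof -
        have "d \<otimes> x = d \<otimes> (x \<otimes> c) \<otimes> d" using d x cc by (simp add: m_assoc)
        also have "x \<otimes> c = c \<otimes> x" using c x by (simp add: central_elem_def)
        also have "d \<otimes> (c \<otimes> x) \<otimes> d = x \<otimes> d" using d x cc by (simp add: m_assoc[symmetric])
        finally show ?thesis .
      qed
      (* the choice that makes P = (1 - t) c for t = y s *)
      define s where "s = \<ominus> (r \<otimes> d)"
      have s: "s \<in> carrier R" using r d by (simp add: s_def)
      have ys: "y \<otimes> s = s \<otimes> y"
      proof -
        have "y \<otimes> (r \<otimes> d) = (r \<otimes> d) \<otimes> y" using y r d dcomm by (metis m_assoc)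
        then show ?thesis using y r d by (simp add: s_def l_minus r_minus)
      qed
      define t where "t = y \<otimes> s"
      have t: "t \<in> carrier R" using y s by (simp add: t_def)
      have ts: "t \<otimes> s = s \<otimes> t" unfolding t_def using ys y s by (metis m_assoc)
      have tk: "t [^] k = y [^] k \<otimes> s [^] k"
        unfolding t_def by (rule pow_mult_distrib[OF ys y s])
      have Pc: "P = (\<one> \<ominus> t) \<otimes> c"
      proof -
        have "t \<otimes> c = \<ominus> (y \<otimes> r)" using y r d cc
          by (simp add: t_def s_def l_minus r_minus m_assoc)
        then show ?thesis unfolding P using y r cc t by (simp add: minus_eq l_distr l_minus a_comm)
      qed
      (* P kills w, hence t fixes it; both e and the vanishing of y^k on f - e come from this *)
      define w where "w = y [^] k \<otimes> f"
      have w: "w \<in> carrier R" using y fc by (simp add: w_def)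
      have Pcl: "P \<in> carrier R" unfolding P using y r cc by simp
      have "w \<otimes> P = \<zero>"
        using less.prems(2) yP fcomm[OF Pcl] y fc Pcl by (simp add: w_def m_assoc)
      then have "w \<otimes> (\<one> \<ominus> t) \<otimes> c \<otimes> d = \<zero>"
        using Pc w t cc d by (simp add: m_assoc)
      then have "w \<otimes> (\<one> \<ominus> t) = \<zero>" using w t cc d by (simp add: m_assoc)
      then have "w \<ominus> w \<otimes> t = \<zero>" using w t by (simp add: minus_eq r_distr r_minus)
      then have wt: "w \<otimes> t = w" using w t by simp
      have pow_absorb: "x \<otimes> t [^] j = x" if "x \<in> carrier R" "x \<otimes> t = x" for x and j :: nat
      proof (induction j)
        case 0
        then show ?case using that by simp
      next
        case (Suc j)
        then show ?case using that t by (simp add: m_assoc[symmetric])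
      qed
      define e where "e = t [^] k \<otimes> f"
      have ec: "e \<in> carrier R" using t fc by (simp add: e_def)
      have ews: "e = w \<otimes> s [^] k"
        unfolding e_def w_def tk using y s fc fcomm[of "s [^] k"] by (simp add: m_assoc)
      have "t \<otimes> s [^] k = s [^] k \<otimes> t"
        using group_commutes_pow[OF ts[symmetric] s t, of k] by simp
      then have et: "e \<otimes> t = e"
        unfolding ews using w s t wt by (metis m_assoc nat_pow_closed)
      have ef: "e \<otimes> f = e" using t fc ff by (simp add: e_def m_assoc)
      have fe: "f \<otimes> e = e" using fcomm[OF ec] ef by simp
      have "e \<otimes> e = e"
        using pow_absorb[OF ec et, of k] ec t fc ef by (simp add: e_def m_assoc[symmetric])
      then have e: "idempotent e" using ec by (simp add: idempotent_def)
      have ecomm: "e \<otimes> x = x \<otimes> e" if "x \<in> carrier R" for x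
        using idc[OF e] that by (simp add: central_elem_def)
      have "P \<otimes> e = e \<otimes> (\<one> \<ominus> t) \<otimes> c"
        using ecomm[OF Pcl] ec t cc by (simp add: Pc m_assoc)
      also have "e \<otimes> (\<one> \<ominus> t) = \<zero>" using ec t et by (simp add: minus_eq r_distr r_minus r_neg)
      finally have "P \<otimes> e = \<zero>" using cc by simp
      then have Qe: "Q e"
        using less.hyps[OF short, of e] LF e unfolding P_def L'_def by auto
      define e' where "e' = f \<ominus> e"
      have e'c: "e' \<in> carrier R" using fc ec by (simp add: e'_def)
      have ee: "e \<otimes> e = e" using e by (simp add: idempotent_def)
      have e'i: "e' \<otimes> e' = e'"
        using fc ec ff ef fe ee
        by (simp add: e'_def minus_eq l_distr r_distr l_minus r_minus r_neg l_neg a_assoc)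
      have e': "idempotent e'" using e'c e'i by (simp add: idempotent_def)
      have ee': "e \<otimes> e' = \<zero>" using fc ec ef ee by (simp add: e'_def minus_eq r_distr r_minus r_neg)
      have sum: "e \<oplus> e' = f" unfolding e'_def using fc ec by algebra
      have "y [^] k \<otimes> e = w"
        using fcomm[of "t [^] k"] y t fc pow_absorb[OF w wt, of k]
        by (simp add: e_def w_def m_assoc)
      then have ye': "y [^] k \<otimes> e' = \<zero>" using y fc ec w
        by (simp add: e'_def minus_eq r_distr r_minus r_neg flip: w_def)
      have "y \<otimes> e' = e' \<otimes> y" using idc[OF e'] y by (simp add: central_elem_def)
      then have "(y \<otimes> e') [^] k = y [^] k \<otimes> e' [^] k"
        using y e'c by (intro pow_mult_distrib) auto
      also have "\<dots> = y [^] k \<otimes> (e' \<otimes> e' [^] (k - 1))"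
        using k e'c nat_pow_Suc2[of e' "k - 1"] by simp
      also have "\<dots> = \<zero>" using ye' y e'c by (simp add: m_assoc[symmetric])
      finally have "nilpotent_elem R (y \<otimes> e')"
        unfolding nilpotent_elem_def using y e'c k by auto
      then have "Q e'" using base e' l unfolding y_def by blast
      then have "Q (e \<oplus> e')" using add e e' ee' Qe by blast
      then show ?thesis by (simp only: sum)
    qed
  qed
  then show "Q f" using L f by (simp add: idempotent_def)
qed

text \<open>On each idempotent of the decomposition \<open>a\<close> is a sum of products of central elements.\<close>

lemma central_if_splits_over:
  assumes idc: "\<And>e. idempotent e \<Longrightarrow> central_elem R e"
    and nil: "\<And>x. nilpotent_elem R x \<Longrightarrow> central_elem R x"
    and central: "\<And>l. l \<in> F \<Longrightarrow> central_elem R l"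
    and a: "a \<in> carrier R" "splits_over F a"
  shows "central_elem R a"
proof -
  have "central_elem R (a \<otimes> \<one>)"
    using a(2)
  proof (rule splits_over_cases[where Q = "\<lambda>f. central_elem R (a \<otimes> f)"])
    show "idempotent \<one>" by (simp add: idempotent_def)
  next
    fix e e' assume "idempotent e" "idempotent e'" "central_elem R (a \<otimes> e)" "central_elem R (a \<otimes> e')"
    then show "central_elem R (a \<otimes> (e \<oplus> e'))"
      using a by (simp add: r_distr idempotent_def central_elem_add)
  next
    fix f l assume f: "idempotent f" and l: "l \<in> F" and n: "nilpotent_elem R ((a \<ominus> l) \<otimes> f)"
    have lc: "l \<in> carrier R" and fc: "f \<in> carrier R"
      using central[OF l] f by (auto simp: central_elem_def idempotent_def)
    have "central_elem R ((a \<ominus> l) \<otimes> f \<oplus> l \<otimes> f)"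
      by (rule central_elem_add[OF nil[OF n] central_elem_mult[OF central[OF l] idc[OF f]]])
    also have "(a \<ominus> l) \<otimes> f \<oplus> l \<otimes> f = a \<otimes> f" using a lc fc by algebra
    finally show "central_elem R (a \<otimes> f)" .
  qed
  then show ?thesis using a by simp
qed

end

section \<open>Splitting in commutative rings\<close>

context cring
begin

lemma nilpotent_elem_mult:
  assumes "nilpotent_elem R x" "y \<in> carrier R"
  shows "nilpotent_elem R (x \<otimes> y)"
  using assms by (auto simp: nilpotent_elem_def nat_pow_distrib)

lemma nilpotent_elem_add:
  assumes "nilpotent_elem R x" "nilpotent_elem R y"
  shows "nilpotent_elem R (x \<oplus> y)"
proof -
  obtain m n :: nat where m: "m > 0" "x [^] m = \<zero>" and n: "n > 0" "y [^] n = \<zero>"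
    using assms by (auto simp: nilpotent_elem_def)
  have x: "x \<in> carrier R" and y: "y \<in> carrier R" using assms by (auto simp: nilpotent_elem_def)
  have x0: "x [^] i = \<zero>" if "m \<le> i" for i
    using nat_pow_mult[OF x, of m "i - m"] m x that by simp
  have y0: "y [^] i = \<zero>" if "n \<le> i" for i
    using nat_pow_mult[OF y, of n "i - n"] n y that by simp
  (* expanding one factor x + y at a time, which spares the binomial theorem *)
  have "(x \<oplus> y) [^] N \<otimes> (x [^] i \<otimes> y [^] j) = \<zero>" if "m + n \<le> N + i + j" for N i j :: nat
    using that
  proof (induction N arbitrary: i j)
    case 0
    then have "m \<le> i \<or> n \<le> j" by linarith
    then show ?case using x y x0 y0 by auto
  next
    case (Suc N)
    have "(x \<oplus> y) [^] Suc N \<otimes> (x [^] i \<otimes> y [^] j) =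
      (x \<oplus> y) [^] N \<otimes> (x [^] Suc i \<otimes> y [^] j) \<oplus> (x \<oplus> y) [^] N \<otimes> (x [^] i \<otimes> y [^] Suc j)"
      using x y by (simp add: l_distr r_distr m_ac)
    then show ?case using Suc.IH[of "Suc i" j] Suc.IH[of i "Suc j"] Suc.prems by simp
  qed
  from this[of "m + n" 0 0] show ?thesis using x y m by (auto simp: nilpotent_elem_def)
qed

text \<open>
The nested induction amounts to refining a decomposition for \<open>a\<close> by one for \<open>b\<close>: on a product
\<open>g h\<close> of idempotents where \<open>a\<close> is \<open>l\<close> and \<open>b\<close> is \<open>m\<close> up to nilpotents, \<open>a + b\<close> is \<open>l + m\<close> up to a
nilpotent.
\<close>

lemma splits_over_add:
  assumes F: "F \<subseteq> carrier R" "\<And>l m. \<lbrakk>l \<in> F; m \<in> F\<rbrakk> \<Longrightarrow> l \<oplus> m \<in> F"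
    and a: "a \<in> carrier R" "splits_over F a" and b: "b \<in> carrier R" "splits_over F b"
  shows "splits_over F (a \<oplus> b)"
  unfolding splits_over_def
proof (intro allI impI)
  fix Q f
  assume add: "\<forall>e e'. idempotent e \<and> idempotent e' \<and> e \<otimes> e' = \<zero> \<and> Q e \<and> Q e' \<longrightarrow> Q (e \<oplus> e')"
    and base: "\<forall>f. idempotent f \<and> (\<exists>l\<in>F. nilpotent_elem R ((a \<oplus> b \<ominus> l) \<otimes> f)) \<longrightarrow> Q f"
  have idem_mult: "idempotent (e \<otimes> e')" if e: "idempotent e" and e': "idempotent e'" for e e'
  proof -
    have c: "e \<in> carrier R" "e' \<in> carrier R" using e e' by (auto simp: idempotent_def)
    then have "e \<otimes> e' \<otimes> (e \<otimes> e') = e \<otimes> e \<otimes> (e' \<otimes> e')" by (simp add: m_ac)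
    then show ?thesis using c e e' by (simp add: idempotent_def)
  qed
  have distribute: "Q (f \<otimes> (e \<oplus> e'))"
    if "idempotent f" "idempotent e" "idempotent e'" "e \<otimes> e' = \<zero>" "Q (f \<otimes> e)" "Q (f \<otimes> e')" for f e e'
  proof -
    have c: "f \<in> carrier R" "e \<in> carrier R" "e' \<in> carrier R" using that by (auto simp: idempotent_def)
    have "(f \<otimes> e) \<otimes> (f \<otimes> e') = f \<otimes> f \<otimes> (e \<otimes> e')" using c by (simp add: m_ac)
    then have "Q (f \<otimes> e \<oplus> f \<otimes> e')" using add that idem_mult c by simp
    then show ?thesis using c by (simp add: r_distr)
  qed
  assume f: "idempotent f"
  show "Q f"
    using a(2) f
  proof (rule splits_over_cases)
    fix e e' assume "idempotent e" "idempotent e'" "e \<otimes> e' = \<zero>" "Q e" "Q e'"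
    then show "Q (e \<oplus> e')" using add by blast
  next
    fix g l assume g: "idempotent g" and l: "l \<in> F" and nl: "nilpotent_elem R ((a \<ominus> l) \<otimes> g)"
    have gc: "g \<in> carrier R" using g by (simp add: idempotent_def)
    have "Q (g \<otimes> \<one>)"
      using b(2)
    proof (rule splits_over_cases[where Q = "\<lambda>e. Q (g \<otimes> e)"])
      show "idempotent \<one>" by (simp add: idempotent_def)
    next
      fix e e' assume "idempotent e" "idempotent e'" "e \<otimes> e' = \<zero>" "Q (g \<otimes> e)" "Q (g \<otimes> e')"
      then show "Q (g \<otimes> (e \<oplus> e'))" using distribute g by blast
    next
      fix h m assume h: "idempotent h" and m: "m \<in> F" and nm: "nilpotent_elem R ((b \<ominus> m) \<otimes> h)"
      have hc: "h \<in> carrier R" using h by (simp add: idempotent_def)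
      have c: "l \<in> carrier R" "m \<in> carrier R" using l m F by auto
      have "nilpotent_elem R ((a \<ominus> l) \<otimes> g \<otimes> h \<oplus> (b \<ominus> m) \<otimes> h \<otimes> g)"
        by (rule nilpotent_elem_add[OF nilpotent_elem_mult[OF nl hc] nilpotent_elem_mult[OF nm gc]])
      also have "(a \<ominus> l) \<otimes> g \<otimes> h \<oplus> (b \<ominus> m) \<otimes> h \<otimes> g = (a \<oplus> b \<ominus> (l \<oplus> m)) \<otimes> (g \<otimes> h)"
        using a b c gc hc by algebra
      finally show "Q (g \<otimes> h)" using base idem_mult[OF g h] F(2)[OF l m] by blast
    qed
    then show "Q g" using gc by simp
  qed
qed

lemma splits_over_smult:
  assumes F: "F \<subseteq> carrier R" "\<And>l. l \<in> F \<Longrightarrow> k \<otimes> l \<in> F" and k: "k \<in> carrier R"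
    and a: "a \<in> carrier R" "splits_over F a"
  shows "splits_over F (k \<otimes> a)"
  unfolding splits_over_def
proof (intro allI impI)
  fix Q f
  assume add: "\<forall>e e'. idempotent e \<and> idempotent e' \<and> e \<otimes> e' = \<zero> \<and> Q e \<and> Q e' \<longrightarrow> Q (e \<oplus> e')"
    and base: "\<forall>f. idempotent f \<and> (\<exists>l\<in>F. nilpotent_elem R ((k \<otimes> a \<ominus> l) \<otimes> f)) \<longrightarrow> Q f"
    and f: "idempotent f"
  show "Q f"
    using a(2) f
  proof (rule splits_over_cases)
    fix e e' assume "idempotent e" "idempotent e'" "e \<otimes> e' = \<zero>" "Q e" "Q e'"
    then show "Q (e \<oplus> e')" using add by blast
  next
    fix g l assume g: "idempotent g" and l: "l \<in> F" and nl: "nilpotent_elem R ((a \<ominus> l) \<otimes> g)"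
    have c: "g \<in> carrier R" "l \<in> carrier R" using g l F by (auto simp: idempotent_def)
    have "(a \<ominus> l) \<otimes> g \<otimes> k = (k \<otimes> a \<ominus> k \<otimes> l) \<otimes> g" using a c k by algebra
    then have "nilpotent_elem R ((k \<otimes> a \<ominus> k \<otimes> l) \<otimes> g)"
      using nilpotent_elem_mult[OF nl k] by simp
    then show "Q g" using base g F(2)[OF l] by blast
  qed
qed

lemma splits_over_in:
  assumes "a \<in> F" "F \<subseteq> carrier R"
  shows "splits_over F a"
  unfolding splits_over_def
proof (intro allI impI)
  fix Q f
  assume "\<forall>f. idempotent f \<and> (\<exists>l\<in>F. nilpotent_elem R ((a \<ominus> l) \<otimes> f)) \<longrightarrow> Q f" and f: "idempotent f"
  moreover have "(a \<ominus> a) \<otimes> f = \<zero>" using assms f by (auto simp: minus_eq r_neg idempotent_def)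
  moreover have "nilpotent_elem R \<zero>" by (auto simp: nilpotent_elem_def intro!: exI[of _ 1])
  ultimately show "Q f" using assms(1) by metis
qed

text \<open>
The element \<open>b\<close> is glued from the inverses of the scalars that approximate \<open>a\<close>, with \<open>0\<close> where \<open>a\<close> is
nilpotent.
\<close>

lemma quasi_inverse_if_splits_over:
  assumes F: "F \<subseteq> carrier R" "\<And>l. l \<in> F \<Longrightarrow> l = \<zero> \<or> l \<in> Units R"
    and a: "a \<in> carrier R" "splits_over F a"
  shows "\<exists>b\<in>carrier R. nilpotent_elem R (a [^] (2::nat) \<otimes> b \<ominus> a)"
proof -
  let ?Q = "\<lambda>f. \<exists>b\<in>carrier R. nilpotent_elem R ((a [^] (2::nat) \<otimes> b \<ominus> a) \<otimes> f)"
  have sq: "a [^] (2::nat) = a \<otimes> a" using a by (simp add: numeral_2_eq_2)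
  have "?Q \<one>"
    using a(2)
  proof (rule splits_over_cases[where Q = ?Q])
    show "idempotent \<one>" by (simp add: idempotent_def)
  next
    fix e e'
    assume e: "idempotent e" and e': "idempotent e'" and ee': "e \<otimes> e' = \<zero>" and "?Q e" and "?Q e'"
    then obtain b b' where b: "b \<in> carrier R" "nilpotent_elem R ((a \<otimes> a \<otimes> b \<ominus> a) \<otimes> e)"
      and b': "b' \<in> carrier R" "nilpotent_elem R ((a \<otimes> a \<otimes> b' \<ominus> a) \<otimes> e')"
      unfolding sq by blast
    have c: "e \<in> carrier R" "e' \<in> carrier R" and i: "e \<otimes> e = e" "e' \<otimes> e' = e'"
      using e e' by (auto simp: idempotent_def)
    let ?b = "b \<otimes> e \<oplus> b' \<otimes> e'"
    have "(a \<otimes> a \<otimes> ?b \<ominus> a) \<otimes> (e \<oplus> e')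
      = (a \<otimes> a \<otimes> b) \<otimes> (e \<otimes> e) \<ominus> a \<otimes> e \<oplus> ((a \<otimes> a \<otimes> b') \<otimes> (e' \<otimes> e') \<ominus> a \<otimes> e')
        \<oplus> (a \<otimes> a \<otimes> (b \<oplus> b')) \<otimes> (e \<otimes> e')"
      using a b(1) b'(1) c by algebra
    also have "\<dots> = (a \<otimes> a \<otimes> b) \<otimes> e \<ominus> a \<otimes> e \<oplus> ((a \<otimes> a \<otimes> b') \<otimes> e' \<ominus> a \<otimes> e')
        \<oplus> (a \<otimes> a \<otimes> (b \<oplus> b')) \<otimes> \<zero>"
      by (simp only: i ee')
    also have "\<dots> = (a \<otimes> a \<otimes> b \<ominus> a) \<otimes> e \<oplus> (a \<otimes> a \<otimes> b' \<ominus> a) \<otimes> e'"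
      using a b(1) b'(1) c by algebra
    finally have "nilpotent_elem R ((a \<otimes> a \<otimes> ?b \<ominus> a) \<otimes> (e \<oplus> e'))"
      using nilpotent_elem_add[OF b(2) b'(2)] by simp
    then show "?Q (e \<oplus> e')" unfolding sq using b b' c by blast
  next
    fix f l assume f: "idempotent f" and l: "l \<in> F" and n: "nilpotent_elem R ((a \<ominus> l) \<otimes> f)"
    have fc: "f \<in> carrier R" and lc: "l \<in> carrier R" using f l F by (auto simp: idempotent_def)
    show "?Q f"
    proof (cases "l = \<zero>")
      case True
      have "(a \<otimes> a \<otimes> \<zero> \<ominus> a) \<otimes> f = (a \<ominus> \<zero>) \<otimes> f \<otimes> (\<ominus> \<one>)" using a fc by algebra
      then have "nilpotent_elem R ((a \<otimes> a \<otimes> \<zero> \<ominus> a) \<otimes> f)"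
        using nilpotent_elem_mult[OF n, of "\<ominus> \<one>"] True by simp
      then show ?thesis unfolding sq by blast
    next
      case False
      then have u: "l \<in> Units R" using F(2) l by blast
      then have ic: "inv l \<in> carrier R" and li: "l \<otimes> inv l = \<one>" by auto
      have "(a \<otimes> a \<otimes> inv l \<ominus> a) \<otimes> f = (a \<otimes> a \<otimes> inv l \<ominus> a \<otimes> (l \<otimes> inv l)) \<otimes> f"
        using a li by simp
      also have "\<dots> = (a \<ominus> l) \<otimes> f \<otimes> (a \<otimes> inv l)" using a fc lc ic by algebra
      finally have "nilpotent_elem R ((a \<otimes> a \<otimes> inv l \<ominus> a) \<otimes> f)"
        using nilpotent_elem_mult[OF n] a ic by simp
      then show ?thesis unfolding sq using ic by blast
    qed
  qed
  then show ?thesis using a by auto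
qed

end

section \<open>Scalars and coefficients in a twisted group algebra\<close>

lemma (in algebraically_closed) root_exists:
  assumes "p \<in> carrier (poly_ring L)" "degree p > 0"
  shows "\<exists>x\<in>carrier L. eval p x = \<zero>"
proof -
  have "size (roots p) > 0" using roots_over_carrier[OF assms(1)] assms(2) by (simp add: splitted_def)
  then obtain x where "x \<in># roots p" by (metis size_empty less_irrefl multiset_nonemptyE)
  then show ?thesis using roots_mem_iff_is_root[OF assms(1)] by (auto simp: is_root_def)
qed

context twisted_group_algebra
begin

definition scalar :: "'k \<Rightarrow> 'a" where
  "scalar k = k \<odot>\<^bsub>A\<^esub> \<one>\<^bsub>A\<^esub>"

abbreviation scalars :: "'a set" where
  "scalars \<equiv> scalar ` carrier K"

lemma u_closed [simp]: "g \<in> carrier G \<Longrightarrow> u g \<in> carrier A"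
  using basis by (auto simp: indexed_basis_def)

lemma induct_basis [consumes 1, case_names zero basis add]:
  assumes x: "x \<in> carrier A"
    and zero: "P \<zero>\<^bsub>A\<^esub>"
    and basis_elem: "\<And>k g. \<lbrakk>k \<in> carrier K; g \<in> carrier G\<rbrakk> \<Longrightarrow> P (k \<odot>\<^bsub>A\<^esub> u g)"
    and add: "\<And>x y. \<lbrakk>x \<in> carrier A; y \<in> carrier A; P x; P y\<rbrakk> \<Longrightarrow> P (x \<oplus>\<^bsub>A\<^esub> y)"
  shows "P x"
proof -
  obtain S c where S: "finite S" "S \<subseteq> carrier G" "c \<in> S \<rightarrow> carrier K"
    and x: "x = (\<Oplus>\<^bsub>A\<^esub>i\<in>S. c i \<odot>\<^bsub>A\<^esub> u i)"
    using basis[unfolded indexed_basis_def, THEN conjunct2, THEN conjunct1, rule_format, OF x]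
    by (elim exE conjE) (rule that)
  have "P (\<Oplus>\<^bsub>A\<^esub>i\<in>S. c i \<odot>\<^bsub>A\<^esub> u i)"
    using S
  proof (induction S rule: finite_induct)
    case empty
    then show ?case using zero by simp
  next
    case (insert g S)
    then have cl: "c i \<in> carrier K" "i \<in> carrier G" if "i \<in> insert g S" for i using that by auto
    then have S: "(\<lambda>i. c i \<odot>\<^bsub>A\<^esub> u i) \<in> S \<rightarrow> carrier A" and g: "c g \<odot>\<^bsub>A\<^esub> u g \<in> carrier A" by auto
    have "P (\<Oplus>\<^bsub>A\<^esub>i\<in>S. c i \<odot>\<^bsub>A\<^esub> u i)" using insert.IH insert.prems by auto
    then have "P (c g \<odot>\<^bsub>A\<^esub> u g \<oplus>\<^bsub>A\<^esub> (\<Oplus>\<^bsub>A\<^esub>i\<in>S. c i \<odot>\<^bsub>A\<^esub> u i))"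
      using add[OF g M.finsum_closed[OF S]] basis_elem cl by blast
    then show ?case using M.finsum_insert[OF insert.hyps S g] by simp
  qed
  then show ?thesis using x by simp
qed

text \<open>The normalization makes \<open>u 1\<close> a left identity, and a left identity of a unital ring is its one.\<close>

lemma u_one: "u \<one>\<^bsub>G\<^esub> = \<one>\<^bsub>A\<^esub>"
proof -
  have "u \<one>\<^bsub>G\<^esub> \<otimes>\<^bsub>A\<^esub> x = x" if "x \<in> carrier A" for x
    using that
  proof (induction x rule: induct_basis)
    case (basis k g)
    then show ?case by (simp add: smult_mult_right basis_mult factor_one_left)
  qed (simp_all add: A.r_distr)
  from this[OF A.one_closed] show ?thesis by simp
qed

lemma scalar_closed [simp]: "k \<in> carrier K \<Longrightarrow> scalar k \<in> carrier A"
  by (simp add: scalar_def)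

lemma scalars_subset: "scalars \<subseteq> carrier A"
  by auto

lemma smult_eq_scalar_mult:
  "\<lbrakk>k \<in> carrier K; x \<in> carrier A\<rbrakk> \<Longrightarrow> k \<odot>\<^bsub>A\<^esub> x = scalar k \<otimes>\<^bsub>A\<^esub> x"
  by (simp add: scalar_def smult_mult_left)

lemma scalar_central: "k \<in> carrier K \<Longrightarrow> central_elem A (scalar k)"
  by (simp add: central_elem_def scalar_def smult_mult_left smult_mult_right)

lemma scalar_add:
  "\<lbrakk>k \<in> carrier K; l \<in> carrier K\<rbrakk> \<Longrightarrow> scalar (k \<oplus>\<^bsub>K\<^esub> l) = scalar k \<oplus>\<^bsub>A\<^esub> scalar l"
  by (simp add: scalar_def smult_l_distr)

lemma scalar_mult:
  "\<lbrakk>k \<in> carrier K; l \<in> carrier K\<rbrakk> \<Longrightarrow> scalar (k \<otimes>\<^bsub>K\<^esub> l) = scalar k \<otimes>\<^bsub>A\<^esub> scalar l"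
  by (simp add: scalar_def smult_assoc1 smult_mult_left)

lemma scalar_one [simp]: "scalar \<one>\<^bsub>K\<^esub> = \<one>\<^bsub>A\<^esub>"
  by (simp add: scalar_def)

lemma scalar_zero [simp]: "scalar \<zero>\<^bsub>K\<^esub> = \<zero>\<^bsub>A\<^esub>"
  by (simp add: scalar_def)

lemma scalar_uminus: "k \<in> carrier K \<Longrightarrow> scalar (\<ominus>\<^bsub>K\<^esub> k) = \<ominus>\<^bsub>A\<^esub> scalar k"
  by (simp add: scalar_def smult_l_minus)

lemma scalar_unit:
  assumes "k \<in> carrier K" "k \<noteq> \<zero>\<^bsub>K\<^esub>"
  shows "scalar k \<in> Units A"
proof -
  have k: "inv\<^bsub>K\<^esub> k \<in> carrier K" "k \<otimes>\<^bsub>K\<^esub> inv\<^bsub>K\<^esub> k = \<one>\<^bsub>K\<^esub>" "inv\<^bsub>K\<^esub> k \<otimes>\<^bsub>K\<^esub> k = \<one>\<^bsub>K\<^esub>"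
    using assms K.field_Units by auto
  then have "scalar k \<otimes>\<^bsub>A\<^esub> scalar (inv\<^bsub>K\<^esub> k) = \<one>\<^bsub>A\<^esub>" "scalar (inv\<^bsub>K\<^esub> k) \<otimes>\<^bsub>A\<^esub> scalar k = \<one>\<^bsub>A\<^esub>"
    using assms by (simp_all flip: scalar_mult)
  then show ?thesis using assms k unfolding Units_def by auto
qed

lemma scalar_diff_unit:
  assumes "x \<in> scalars" "y \<in> scalars" "x \<noteq> y"
  shows "x \<ominus>\<^bsub>A\<^esub> y \<in> Units A"
proof -
  obtain k l where kl: "k \<in> carrier K" "l \<in> carrier K" "x = scalar k" "y = scalar l"
    using assms by blast
  then have "x \<ominus>\<^bsub>A\<^esub> y = scalar (k \<ominus>\<^bsub>K\<^esub> l)"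
    by (simp add: M.minus_eq K.minus_eq scalar_add scalar_uminus)
  moreover have "k \<ominus>\<^bsub>K\<^esub> l \<noteq> \<zero>\<^bsub>K\<^esub>" using kl assms(3) by auto
  ultimately show ?thesis using kl scalar_unit by simp
qed

text \<open>
Coefficient functions are total on \<open>G\<close>, with an unspecified finite set outside which they vanish, so that
they can be added and translated without adjusting index sets. Off \<open>carrier G\<close> they are arbitrary.
\<close>

definition represents :: "('g \<Rightarrow> 'k) \<Rightarrow> 'a \<Rightarrow> bool" where
  "represents c x \<longleftrightarrow> c \<in> carrier G \<rightarrow> carrier K \<and>
     (\<exists>S. finite S \<and> S \<subseteq> carrier G \<and> (\<forall>g\<in>carrier G - S. c g = \<zero>\<^bsub>K\<^esub>) \<and>
          x = (\<Oplus>\<^bsub>A\<^esub>g\<in>S. c g \<odot>\<^bsub>A\<^esub> u g))"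

lemma representsE:
  assumes "represents c x"
  obtains S where "c \<in> carrier G \<rightarrow> carrier K" "finite S" "S \<subseteq> carrier G"
    "\<forall>g\<in>carrier G - S. c g = \<zero>\<^bsub>K\<^esub>" "x = (\<Oplus>\<^bsub>A\<^esub>g\<in>S. c g \<odot>\<^bsub>A\<^esub> u g)"
  using assms unfolding represents_def by (elim conjE exE) (rule that)

lemma represents_enlarge:
  assumes c: "c \<in> carrier G \<rightarrow> carrier K" and S: "S \<subseteq> T" "finite T" "T \<subseteq> carrier G"
    and zero: "\<forall>g\<in>carrier G - S. c g = \<zero>\<^bsub>K\<^esub>"
  shows "(\<Oplus>\<^bsub>A\<^esub>g\<in>S. c g \<odot>\<^bsub>A\<^esub> u g) = (\<Oplus>\<^bsub>A\<^esub>g\<in>T. c g \<odot>\<^bsub>A\<^esub> u g)"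
proof (rule M.add.finprod_mono_neutral_cong_left[OF S(2,1)])
  show "c i \<odot>\<^bsub>A\<^esub> u i = \<zero>\<^bsub>A\<^esub>" if "i \<in> T - S" for i
  proof -
    have "i \<in> carrier G" using that S by blast
    then show ?thesis using that zero by simp
  qed
  show "(\<lambda>i. c i \<odot>\<^bsub>A\<^esub> u i) \<in> T \<rightarrow> carrier A" using c S by (auto intro!: smult_closed)
qed simp

lemma represents_finite_support:
  assumes "represents c x"
  shows "finite {g \<in> carrier G. c g \<noteq> \<zero>\<^bsub>K\<^esub>}"
proof -
  obtain S where "finite S" "\<forall>g\<in>carrier G - S. c g = \<zero>\<^bsub>K\<^esub>"
    using assms by (rule representsE) (rule that)
  then show ?thesis by (elim rev_finite_subset) auto
qed

lemma represents_closed: "\<lbrakk>represents c x; g \<in> carrier G\<rbrakk> \<Longrightarrow> c g \<in> carrier K"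
  unfolding represents_def by auto

lemma represents_eq_zero:
  assumes "represents c x" "\<And>g. g \<in> carrier G \<Longrightarrow> c g = \<zero>\<^bsub>K\<^esub>"
  shows "x = \<zero>\<^bsub>A\<^esub>"
proof -
  obtain S where S: "finite S" "S \<subseteq> carrier G" "x = (\<Oplus>\<^bsub>A\<^esub>g\<in>S. c g \<odot>\<^bsub>A\<^esub> u g)"
    and c: "c \<in> carrier G \<rightarrow> carrier K"
    using assms(1) by (rule representsE) (rule that)
  have "(\<Oplus>\<^bsub>A\<^esub>g\<in>S. c g \<odot>\<^bsub>A\<^esub> u g) = (\<Oplus>\<^bsub>A\<^esub>g\<in>{}. c g \<odot>\<^bsub>A\<^esub> u g)"
    using represents_enlarge[OF c, of "{}" S] S assms(2) by simp
  then show ?thesis using S by simp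
qed

lemma represents_zero_imp:
  assumes "represents c \<zero>\<^bsub>A\<^esub>" "g \<in> carrier G"
  shows "c g = \<zero>\<^bsub>K\<^esub>"
proof -
  obtain S where S: "finite S" "S \<subseteq> carrier G" "\<forall>g\<in>carrier G - S. c g = \<zero>\<^bsub>K\<^esub>"
    "\<zero>\<^bsub>A\<^esub> = (\<Oplus>\<^bsub>A\<^esub>g\<in>S. c g \<odot>\<^bsub>A\<^esub> u g)" and c: "c \<in> carrier G \<rightarrow> carrier K"
    using assms(1) by (rule representsE) (rule that)
  have "c \<in> S \<rightarrow> carrier K" using c S by auto
  then have "\<forall>g\<in>S. c g = \<zero>\<^bsub>K\<^esub>"
    using basis S(1,2) S(4)[symmetric] unfolding indexed_basis_def by blast
  then show ?thesis using S assms(2) by blast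
qed

lemma represents_cong:
  assumes "represents c x" "\<And>g. g \<in> carrier G \<Longrightarrow> d g = c g"
  shows "represents d x"
proof -
  obtain S where S: "finite S" "S \<subseteq> carrier G" "\<forall>g\<in>carrier G - S. c g = \<zero>\<^bsub>K\<^esub>"
    "x = (\<Oplus>\<^bsub>A\<^esub>g\<in>S. c g \<odot>\<^bsub>A\<^esub> u g)" and c: "c \<in> carrier G \<rightarrow> carrier K"
    using assms(1) by (rule representsE) (rule that)
  have "x = (\<Oplus>\<^bsub>A\<^esub>g\<in>S. d g \<odot>\<^bsub>A\<^esub> u g)"
    unfolding S(4)
  proof (rule M.finsum_cong'[OF refl])
    show "(\<lambda>g. d g \<odot>\<^bsub>A\<^esub> u g) \<in> S \<rightarrow> carrier A"
    proof
      fix i assume "i \<in> S"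
      then have "i \<in> carrier G" using S by blast
      then show "d i \<odot>\<^bsub>A\<^esub> u i \<in> carrier A" using c assms(2) by auto
    qed
    show "c i \<odot>\<^bsub>A\<^esub> u i = d i \<odot>\<^bsub>A\<^esub> u i" if "i \<in> S" for i using assms(2) S that by auto
  qed
  moreover have "d \<in> carrier G \<rightarrow> carrier K" using c assms(2) by auto
  ultimately show ?thesis using S assms(2) unfolding represents_def by (intro conjI exI[of _ S]) auto
qed

lemma represents_basis:
  assumes "k \<in> carrier K" "g \<in> carrier G"
  shows "represents (\<lambda>h. if h = g then k else \<zero>\<^bsub>K\<^esub>) (k \<odot>\<^bsub>A\<^esub> u g)"
  using assms unfolding represents_def by (intro conjI exI[of _ "{g}"]) auto

lemma represents_add:
  assumes cx: "represents c x" and dy: "represents d y"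
  shows "represents (\<lambda>g. c g \<oplus>\<^bsub>K\<^esub> d g) (x \<oplus>\<^bsub>A\<^esub> y)"
proof -
  obtain S where S: "finite S" "S \<subseteq> carrier G" "\<forall>g\<in>carrier G - S. c g = \<zero>\<^bsub>K\<^esub>"
    "x = (\<Oplus>\<^bsub>A\<^esub>g\<in>S. c g \<odot>\<^bsub>A\<^esub> u g)" and c: "c \<in> carrier G \<rightarrow> carrier K"
    using cx by (rule representsE) (rule that)
  obtain T where T: "finite T" "T \<subseteq> carrier G" "\<forall>g\<in>carrier G - T. d g = \<zero>\<^bsub>K\<^esub>"
    "y = (\<Oplus>\<^bsub>A\<^esub>g\<in>T. d g \<odot>\<^bsub>A\<^esub> u g)" and d: "d \<in> carrier G \<rightarrow> carrier K"
    using dy by (rule representsE) (rule that)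
  let ?U = "S \<union> T"
  have x: "x = (\<Oplus>\<^bsub>A\<^esub>g\<in>?U. c g \<odot>\<^bsub>A\<^esub> u g)" and y: "y = (\<Oplus>\<^bsub>A\<^esub>g\<in>?U. d g \<odot>\<^bsub>A\<^esub> u g)"
    using represents_enlarge[OF c, of S ?U] represents_enlarge[OF d, of T ?U] S T by auto
  have cl: "c g \<in> carrier K" "d g \<in> carrier K" "g \<in> carrier G" if "g \<in> ?U" for g
    using c d S T that by auto
  have "x \<oplus>\<^bsub>A\<^esub> y = (\<Oplus>\<^bsub>A\<^esub>g\<in>?U. c g \<odot>\<^bsub>A\<^esub> u g \<oplus>\<^bsub>A\<^esub> d g \<odot>\<^bsub>A\<^esub> u g)"
    unfolding x y using cl by (intro M.finsum_addf[symmetric]) auto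
  also have "\<dots> = (\<Oplus>\<^bsub>A\<^esub>g\<in>?U. (c g \<oplus>\<^bsub>K\<^esub> d g) \<odot>\<^bsub>A\<^esub> u g)"
    using cl by (intro M.finsum_cong'[OF refl]) (auto simp: smult_l_distr)
  finally have "x \<oplus>\<^bsub>A\<^esub> y = (\<Oplus>\<^bsub>A\<^esub>g\<in>?U. (c g \<oplus>\<^bsub>K\<^esub> d g) \<odot>\<^bsub>A\<^esub> u g)" .
  then show ?thesis using c d S T unfolding represents_def by (intro conjI exI[of _ ?U]) auto
qed

lemma represents_smult:
  assumes cx: "represents c x" and k: "k \<in> carrier K"
  shows "represents (\<lambda>g. k \<otimes>\<^bsub>K\<^esub> c g) (k \<odot>\<^bsub>A\<^esub> x)"
proof -
  obtain S where S: "finite S" "S \<subseteq> carrier G" "\<forall>g\<in>carrier G - S. c g = \<zero>\<^bsub>K\<^esub>"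
    "x = (\<Oplus>\<^bsub>A\<^esub>g\<in>S. c g \<odot>\<^bsub>A\<^esub> u g)" and c: "c \<in> carrier G \<rightarrow> carrier K"
    using cx by (rule representsE) (rule that)
  have cl: "c g \<in> carrier K" "g \<in> carrier G" if "g \<in> S" for g using c S that by auto
  have "k \<odot>\<^bsub>A\<^esub> x = (\<Oplus>\<^bsub>A\<^esub>g\<in>S. k \<odot>\<^bsub>A\<^esub> (c g \<odot>\<^bsub>A\<^esub> u g))"
    unfolding S(4) using cl k S by (intro finsum_smult_ldistr) auto
  also have "\<dots> = (\<Oplus>\<^bsub>A\<^esub>g\<in>S. (k \<otimes>\<^bsub>K\<^esub> c g) \<odot>\<^bsub>A\<^esub> u g)"
    using cl k by (intro M.finsum_cong'[OF refl]) (auto simp: smult_assoc1)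
  finally show ?thesis using c S k unfolding represents_def by (intro conjI exI[of _ S]) auto
qed

lemma represents_unique:
  assumes cx: "represents c x" and dx: "represents d x" and x: "x \<in> carrier A" and g: "g \<in> carrier G"
  shows "c g = d g"
proof -
  have "represents (\<lambda>g. c g \<oplus>\<^bsub>K\<^esub> (\<ominus>\<^bsub>K\<^esub> \<one>\<^bsub>K\<^esub>) \<otimes>\<^bsub>K\<^esub> d g) (x \<oplus>\<^bsub>A\<^esub> (\<ominus>\<^bsub>K\<^esub> \<one>\<^bsub>K\<^esub>) \<odot>\<^bsub>A\<^esub> x)"
    by (rule represents_add[OF cx represents_smult[OF dx]]) simp
  also have "x \<oplus>\<^bsub>A\<^esub> (\<ominus>\<^bsub>K\<^esub> \<one>\<^bsub>K\<^esub>) \<odot>\<^bsub>A\<^esub> x = \<zero>\<^bsub>A\<^esub>"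
    using x by (simp add: smult_l_minus M.r_neg)
  finally have "c g \<oplus>\<^bsub>K\<^esub> (\<ominus>\<^bsub>K\<^esub> \<one>\<^bsub>K\<^esub>) \<otimes>\<^bsub>K\<^esub> d g = \<zero>\<^bsub>K\<^esub>" using g by (rule represents_zero_imp)
  moreover have "c g \<in> carrier K" "d g \<in> carrier K"
    using cx dx g by (auto intro: represents_closed)
  ultimately show ?thesis by (simp add: K.l_minus flip: K.minus_eq)
qed

lemma represents_translate:
  assumes x: "x \<in> carrier A" and g: "g \<in> carrier G"
  shows "\<exists>c. represents c x \<and>
    represents (\<lambda>h. \<rho> g (inv\<^bsub>G\<^esub> g \<otimes>\<^bsub>G\<^esub> h) \<otimes>\<^bsub>K\<^esub> c (inv\<^bsub>G\<^esub> g \<otimes>\<^bsub>G\<^esub> h)) (u g \<otimes>\<^bsub>A\<^esub> x)"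
  using x
proof (induction x rule: induct_basis)
  case zero
  have "represents (\<lambda>h. \<zero>\<^bsub>K\<^esub>) \<zero>\<^bsub>A\<^esub>"
    unfolding represents_def by (intro conjI exI[of _ "{}"]) auto
  moreover from this have "represents (\<lambda>h. \<rho> g (inv\<^bsub>G\<^esub> g \<otimes>\<^bsub>G\<^esub> h) \<otimes>\<^bsub>K\<^esub> \<zero>\<^bsub>K\<^esub>) \<zero>\<^bsub>A\<^esub>"
    by (rule represents_cong) (simp add: g factor_closed)
  ultimately show ?case using g by auto
next
  case (basis k s)
  have eq: "u g \<otimes>\<^bsub>A\<^esub> (k \<odot>\<^bsub>A\<^esub> u s) = (\<rho> g s \<otimes>\<^bsub>K\<^esub> k) \<odot>\<^bsub>A\<^esub> u (g \<otimes>\<^bsub>G\<^esub> s)"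
    using basis g
    by (simp add: smult_mult_right basis_mult factor_closed K.m_comm[of "\<rho> g s"] smult_assoc1)
  have "represents (\<lambda>h. if h = g \<otimes>\<^bsub>G\<^esub> s then \<rho> g s \<otimes>\<^bsub>K\<^esub> k else \<zero>\<^bsub>K\<^esub>) (u g \<otimes>\<^bsub>A\<^esub> (k \<odot>\<^bsub>A\<^esub> u s))"
    unfolding eq using basis g by (intro represents_basis) (auto simp: factor_closed)
  then have "represents (\<lambda>h. \<rho> g (inv\<^bsub>G\<^esub> g \<otimes>\<^bsub>G\<^esub> h) \<otimes>\<^bsub>K\<^esub>
      (if inv\<^bsub>G\<^esub> g \<otimes>\<^bsub>G\<^esub> h = s then k else \<zero>\<^bsub>K\<^esub>)) (u g \<otimes>\<^bsub>A\<^esub> (k \<odot>\<^bsub>A\<^esub> u s))"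
  proof (rule represents_cong)
    fix h assume h: "h \<in> carrier G"
    have "inv\<^bsub>G\<^esub> g \<otimes>\<^bsub>G\<^esub> h = s \<longleftrightarrow> h = g \<otimes>\<^bsub>G\<^esub> s"
      using G.inv_solve_left'[of s g h] basis g h by auto
    then show "\<rho> g (inv\<^bsub>G\<^esub> g \<otimes>\<^bsub>G\<^esub> h) \<otimes>\<^bsub>K\<^esub> (if inv\<^bsub>G\<^esub> g \<otimes>\<^bsub>G\<^esub> h = s then k else \<zero>\<^bsub>K\<^esub>) =
      (if h = g \<otimes>\<^bsub>G\<^esub> s then \<rho> g s \<otimes>\<^bsub>K\<^esub> k else \<zero>\<^bsub>K\<^esub>)"
      using h g factor_closed by auto
  qed
  then show ?case using represents_basis basis by blast
next
  case (add x y)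
  let ?t = "\<lambda>c h. \<rho> g (inv\<^bsub>G\<^esub> g \<otimes>\<^bsub>G\<^esub> h) \<otimes>\<^bsub>K\<^esub> c (inv\<^bsub>G\<^esub> g \<otimes>\<^bsub>G\<^esub> h)"
  obtain c d where c: "represents c x" "represents (?t c) (u g \<otimes>\<^bsub>A\<^esub> x)"
    and d: "represents d y" "represents (?t d) (u g \<otimes>\<^bsub>A\<^esub> y)"
    using add by blast
  have "represents (?t (\<lambda>h. c h \<oplus>\<^bsub>K\<^esub> d h)) (u g \<otimes>\<^bsub>A\<^esub> x \<oplus>\<^bsub>A\<^esub> u g \<otimes>\<^bsub>A\<^esub> y)"
  proof (rule represents_cong[OF represents_add[OF c(2) d(2)]])
    fix h assume "h \<in> carrier G"
    then have h: "inv\<^bsub>G\<^esub> g \<otimes>\<^bsub>G\<^esub> h \<in> carrier G" using g by simp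
    show "?t (\<lambda>h. c h \<oplus>\<^bsub>K\<^esub> d h) h = ?t c h \<oplus>\<^bsub>K\<^esub> ?t d h"
      using represents_closed[OF c(1) h] represents_closed[OF d(1) h] factor_closed[OF g h]
      by (simp add: K.r_distr)
  qed
  then have "represents (?t (\<lambda>h. c h \<oplus>\<^bsub>K\<^esub> d h)) (u g \<otimes>\<^bsub>A\<^esub> (x \<oplus>\<^bsub>A\<^esub> y))"
    using add g by (simp add: A.r_distr)
  then show ?case using represents_add[OF c(1) d(1)] by blast
qed

text \<open>
If \<open>(1 - u g) x\<close> is the scalar \<open>k\<close>, then \<open>x = u g x + k\<close>. Comparing coefficients, the support of \<open>x\<close> is
invariant under \<open>g\<close> except for the step that ends at the identity of \<open>G\<close>, where \<open>k\<close> enters.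
\<close>

lemma translate_difference_coefficients:
  assumes x: "x \<in> carrier A" and g: "g \<in> carrier G" and k: "k \<in> carrier K"
    and eq: "(\<one>\<^bsub>A\<^esub> \<ominus>\<^bsub>A\<^esub> u g) \<otimes>\<^bsub>A\<^esub> x = scalar k"
  obtains c where "represents c x"
    "\<And>h. \<lbrakk>h \<in> carrier G; g \<otimes>\<^bsub>G\<^esub> h \<noteq> \<one>\<^bsub>G\<^esub>\<rbrakk> \<Longrightarrow> c (g \<otimes>\<^bsub>G\<^esub> h) = \<zero>\<^bsub>K\<^esub> \<longleftrightarrow> c h = \<zero>\<^bsub>K\<^esub>"
    "c \<one>\<^bsub>G\<^esub> = \<rho> g (inv\<^bsub>G\<^esub> g) \<otimes>\<^bsub>K\<^esub> c (inv\<^bsub>G\<^esub> g) \<oplus>\<^bsub>K\<^esub> k"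
proof -
  obtain c where c: "represents c x"
    "represents (\<lambda>h. \<rho> g (inv\<^bsub>G\<^esub> g \<otimes>\<^bsub>G\<^esub> h) \<otimes>\<^bsub>K\<^esub> c (inv\<^bsub>G\<^esub> g \<otimes>\<^bsub>G\<^esub> h)) (u g \<otimes>\<^bsub>A\<^esub> x)"
    using represents_translate[OF x g] by blast
  have "x = u g \<otimes>\<^bsub>A\<^esub> x \<oplus>\<^bsub>A\<^esub> (\<one>\<^bsub>A\<^esub> \<ominus>\<^bsub>A\<^esub> u g) \<otimes>\<^bsub>A\<^esub> x"
    using x u_closed[OF g] by algebra
  then have xe: "x = u g \<otimes>\<^bsub>A\<^esub> x \<oplus>\<^bsub>A\<^esub> k \<odot>\<^bsub>A\<^esub> u \<one>\<^bsub>G\<^esub>" using eq by (simp add: scalar_def u_one)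
  have rep: "represents (\<lambda>h. \<rho> g (inv\<^bsub>G\<^esub> g \<otimes>\<^bsub>G\<^esub> h) \<otimes>\<^bsub>K\<^esub> c (inv\<^bsub>G\<^esub> g \<otimes>\<^bsub>G\<^esub> h)
      \<oplus>\<^bsub>K\<^esub> (if h = \<one>\<^bsub>G\<^esub> then k else \<zero>\<^bsub>K\<^esub>)) x"
    by (subst xe) (rule represents_add[OF c(2) represents_basis[OF k G.one_closed]])
  have coeff: "c h = \<rho> g (inv\<^bsub>G\<^esub> g \<otimes>\<^bsub>G\<^esub> h) \<otimes>\<^bsub>K\<^esub> c (inv\<^bsub>G\<^esub> g \<otimes>\<^bsub>G\<^esub> h)
      \<oplus>\<^bsub>K\<^esub> (if h = \<one>\<^bsub>G\<^esub> then k else \<zero>\<^bsub>K\<^esub>)" if "h \<in> carrier G" for h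
    by (rule represents_unique[OF c(1) rep x that])
  show thesis
  proof (rule that[OF c(1)])
    fix h assume h: "h \<in> carrier G" and ne: "g \<otimes>\<^bsub>G\<^esub> h \<noteq> \<one>\<^bsub>G\<^esub>"
    have "inv\<^bsub>G\<^esub> g \<otimes>\<^bsub>G\<^esub> (g \<otimes>\<^bsub>G\<^esub> h) = h" using g h by (simp add: G.m_assoc[symmetric])
    moreover have "c h \<in> carrier K" "\<rho> g h \<in> carrier K" "\<rho> g h \<noteq> \<zero>\<^bsub>K\<^esub>"
      using c(1) g h by (auto intro: represents_closed factor_closed factor_nonzero simp: factor_nonzero)
    ultimately show "c (g \<otimes>\<^bsub>G\<^esub> h) = \<zero>\<^bsub>K\<^esub> \<longleftrightarrow> c h = \<zero>\<^bsub>K\<^esub>"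
      using coeff[of "g \<otimes>\<^bsub>G\<^esub> h"] ne g h by (simp add: K.integral_iff)
  next
    show "c \<one>\<^bsub>G\<^esub> = \<rho> g (inv\<^bsub>G\<^esub> g) \<otimes>\<^bsub>K\<^esub> c (inv\<^bsub>G\<^esub> g) \<oplus>\<^bsub>K\<^esub> k"
      using coeff[of "\<one>\<^bsub>G\<^esub>"] g by simp
  qed
qed

section \<open>Elements of infinite order\<close>

lemma coefficient_vanishes_on_orbit:
  assumes c: "represents c x" and g: "g \<in> carrier G" and h: "h \<in> carrier G"
    and inf: "\<And>n::nat. n > 0 \<Longrightarrow> g [^]\<^bsub>G\<^esub> n \<noteq> \<one>\<^bsub>G\<^esub>"
  shows "\<exists>n::nat. c (g [^]\<^bsub>G\<^esub> n \<otimes>\<^bsub>G\<^esub> h) = \<zero>\<^bsub>K\<^esub>"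
proof (rule ccontr)
  assume "\<nexists>n::nat. c (g [^]\<^bsub>G\<^esub> n \<otimes>\<^bsub>G\<^esub> h) = \<zero>\<^bsub>K\<^esub>"
  then have "range (\<lambda>n::nat. g [^]\<^bsub>G\<^esub> n \<otimes>\<^bsub>G\<^esub> h) \<subseteq> {g \<in> carrier G. c g \<noteq> \<zero>\<^bsub>K\<^esub>}"
    using g h by auto
  moreover have "inj (\<lambda>n::nat. g [^]\<^bsub>G\<^esub> n \<otimes>\<^bsub>G\<^esub> h)"
  proof (rule linorder_injI)
    fix m n :: nat assume "m < n"
    then show "g [^]\<^bsub>G\<^esub> m \<otimes>\<^bsub>G\<^esub> h \<noteq> g [^]\<^bsub>G\<^esub> n \<otimes>\<^bsub>G\<^esub> h"
      using inf[of "n - m"] G.pow_eq_div2[OF g, of n m] g h by auto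
  qed
  ultimately show False
    using represents_finite_support[OF c] finite_subset range_inj_infinite by blast
qed

text \<open>Here \<open>k = 0\<close>, so the finite support of \<open>x\<close> is invariant under \<open>g\<close> and thus empty.\<close>

lemma infinite_order_left_cancellable:
  assumes g: "g \<in> carrier G" and inf: "\<And>n::nat. n > 0 \<Longrightarrow> g [^]\<^bsub>G\<^esub> n \<noteq> \<one>\<^bsub>G\<^esub>"
    and x: "x \<in> carrier A" and eq: "(\<one>\<^bsub>A\<^esub> \<ominus>\<^bsub>A\<^esub> u g) \<otimes>\<^bsub>A\<^esub> x = \<zero>\<^bsub>A\<^esub>"
  shows "x = \<zero>\<^bsub>A\<^esub>"
proof -
  obtain c where c: "represents c x"
    and step: "\<And>h. \<lbrakk>h \<in> carrier G; g \<otimes>\<^bsub>G\<^esub> h \<noteq> \<one>\<^bsub>G\<^esub>\<rbrakk> \<Longrightarrow> c (g \<otimes>\<^bsub>G\<^esub> h) = \<zero>\<^bsub>K\<^esub> \<longleftrightarrow> c h = \<zero>\<^bsub>K\<^esub>"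
    and one: "c \<one>\<^bsub>G\<^esub> = \<rho> g (inv\<^bsub>G\<^esub> g) \<otimes>\<^bsub>K\<^esub> c (inv\<^bsub>G\<^esub> g) \<oplus>\<^bsub>K\<^esub> \<zero>\<^bsub>K\<^esub>"
    using translate_difference_coefficients[OF x g K.zero_closed] eq by (metis scalar_zero)
  have step': "c (g \<otimes>\<^bsub>G\<^esub> h) = \<zero>\<^bsub>K\<^esub> \<longleftrightarrow> c h = \<zero>\<^bsub>K\<^esub>" if h: "h \<in> carrier G" for h
  proof (cases "g \<otimes>\<^bsub>G\<^esub> h = \<one>\<^bsub>G\<^esub>")
    case True
    then have "h = inv\<^bsub>G\<^esub> g" using g h by (metis G.inv_equality G.inv_comm)
    moreover have "c h \<in> carrier K" "\<rho> g h \<in> carrier K" "\<rho> g h \<noteq> \<zero>\<^bsub>K\<^esub>"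
      using c g h by (auto intro: represents_closed factor_closed simp: factor_nonzero)
    ultimately show ?thesis using one True by (simp add: K.integral_iff)
  qed (use h step in auto)
  have "c h = \<zero>\<^bsub>K\<^esub>" if h: "h \<in> carrier G" for h
  proof -
    obtain n :: nat where n: "c (g [^]\<^bsub>G\<^esub> n \<otimes>\<^bsub>G\<^esub> h) = \<zero>\<^bsub>K\<^esub>"
      using coefficient_vanishes_on_orbit[OF c g h inf] by blast
    have "c (g [^]\<^bsub>G\<^esub> m \<otimes>\<^bsub>G\<^esub> h) = \<zero>\<^bsub>K\<^esub> \<longleftrightarrow> c h = \<zero>\<^bsub>K\<^esub>" for m :: nat
    proof (induction m)
      case (Suc m)
      have "g [^]\<^bsub>G\<^esub> Suc m \<otimes>\<^bsub>G\<^esub> h = g \<otimes>\<^bsub>G\<^esub> (g [^]\<^bsub>G\<^esub> m \<otimes>\<^bsub>G\<^esub> h)"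
        using g h by (simp only: G.nat_pow_Suc2 G.m_assoc G.nat_pow_closed)
      then show ?case using Suc step'[of "g [^]\<^bsub>G\<^esub> m \<otimes>\<^bsub>G\<^esub> h"] g h by simp
    qed (use h in simp)
    then show ?thesis using n by blast
  qed
  then show ?thesis using represents_eq_zero[OF c] by blast
qed

text \<open>
Here \<open>k = 1\<close>. Finiteness of the support along \<open>1, g, g^2, \<dots>\<close> makes the coefficient at \<open>1\<close> zero, and
along \<open>g^-1, g^-2, \<dots>\<close> it makes the coefficient at \<open>g^-1\<close> zero; but these two coefficients differ, up
to a factor, by \<open>k\<close>.
\<close>

lemma infinite_order_not_right_invertible:
  assumes g: "g \<in> carrier G" and inf: "\<And>n::nat. n > 0 \<Longrightarrow> g [^]\<^bsub>G\<^esub> n \<noteq> \<one>\<^bsub>G\<^esub>"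
    and x: "x \<in> carrier A"
  shows "(\<one>\<^bsub>A\<^esub> \<ominus>\<^bsub>A\<^esub> u g) \<otimes>\<^bsub>A\<^esub> x \<noteq> \<one>\<^bsub>A\<^esub>"
proof
  assume eq: "(\<one>\<^bsub>A\<^esub> \<ominus>\<^bsub>A\<^esub> u g) \<otimes>\<^bsub>A\<^esub> x = \<one>\<^bsub>A\<^esub>"
  obtain c where c: "represents c x"
    and step: "\<And>h. \<lbrakk>h \<in> carrier G; g \<otimes>\<^bsub>G\<^esub> h \<noteq> \<one>\<^bsub>G\<^esub>\<rbrakk> \<Longrightarrow> c (g \<otimes>\<^bsub>G\<^esub> h) = \<zero>\<^bsub>K\<^esub> \<longleftrightarrow> c h = \<zero>\<^bsub>K\<^esub>"
    and one: "c \<one>\<^bsub>G\<^esub> = \<rho> g (inv\<^bsub>G\<^esub> g) \<otimes>\<^bsub>K\<^esub> c (inv\<^bsub>G\<^esub> g) \<oplus>\<^bsub>K\<^esub> \<one>\<^bsub>K\<^esub>"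
    using translate_difference_coefficients[OF x g K.one_closed] eq by (metis scalar_one)
  let ?i = "inv\<^bsub>G\<^esub> g"
  have i: "?i \<in> carrier G" using g by simp
  have forward: "c (g [^]\<^bsub>G\<^esub> n) = \<zero>\<^bsub>K\<^esub> \<longleftrightarrow> c \<one>\<^bsub>G\<^esub> = \<zero>\<^bsub>K\<^esub>" for n :: nat
  proof (induction n)
    case (Suc n)
    have "g [^]\<^bsub>G\<^esub> Suc n = g \<otimes>\<^bsub>G\<^esub> g [^]\<^bsub>G\<^esub> n" using g by (simp only: G.nat_pow_Suc2)
    then show ?case using Suc step[of "g [^]\<^bsub>G\<^esub> n"] inf[of "Suc n"] g by simp
  qed simp
  have inf': "?i [^]\<^bsub>G\<^esub> n \<noteq> \<one>\<^bsub>G\<^esub>" if "n > 0" for n :: nat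
    using inf[OF that] g by (metis G.inv_eq_1_iff G.nat_pow_closed G.nat_pow_inv)
  have backward: "c (?i [^]\<^bsub>G\<^esub> n \<otimes>\<^bsub>G\<^esub> ?i) = \<zero>\<^bsub>K\<^esub> \<longleftrightarrow> c ?i = \<zero>\<^bsub>K\<^esub>" for n :: nat
  proof (induction n)
    case (Suc n)
    have "g \<otimes>\<^bsub>G\<^esub> (?i [^]\<^bsub>G\<^esub> Suc n \<otimes>\<^bsub>G\<^esub> ?i) = ?i [^]\<^bsub>G\<^esub> n \<otimes>\<^bsub>G\<^esub> ?i"
      using g i by (simp only: G.nat_pow_Suc2) (simp add: G.m_assoc[symmetric])
    moreover have "?i [^]\<^bsub>G\<^esub> n \<otimes>\<^bsub>G\<^esub> ?i \<noteq> \<one>\<^bsub>G\<^esub>" using inf'[of "Suc n"] by simp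
    ultimately show ?case using Suc step[of "?i [^]\<^bsub>G\<^esub> Suc n \<otimes>\<^bsub>G\<^esub> ?i"] i by simp
  qed (use i in simp)
  have "c \<one>\<^bsub>G\<^esub> = \<zero>\<^bsub>K\<^esub>"
    using coefficient_vanishes_on_orbit[OF c g G.one_closed inf] forward g by simp
  moreover have "c ?i = \<zero>\<^bsub>K\<^esub>"
    using coefficient_vanishes_on_orbit[OF c i i inf'] backward by simp
  ultimately show False using one i g factor_closed by simp
qed

lemma torsion_if_xiN:
  assumes xi: "xiN_ring A" and g: "g \<in> carrier G"
  shows "\<exists>n::nat. n > 0 \<and> g [^]\<^bsub>G\<^esub> n = \<one>\<^bsub>G\<^esub>"
proof (rule ccontr)
  assume "\<not> ?thesis"
  then have inf: "g [^]\<^bsub>G\<^esub> n \<noteq> \<one>\<^bsub>G\<^esub>" if "n > 0" for n :: nat using that by blast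
  have "\<exists>b\<in>carrier A. (\<one>\<^bsub>A\<^esub> \<ominus>\<^bsub>A\<^esub> u g) \<otimes>\<^bsub>A\<^esub> b = \<one>\<^bsub>A\<^esub>"
    by (rule A.right_invertible_if_left_cancellable[OF xi])
       (use g infinite_order_left_cancellable[OF g inf] in auto)
  then show False using infinite_order_not_right_invertible[OF g inf] by blast
qed

section \<open>Elements of finite order\<close>

text \<open>
Horner's scheme: the coefficients of the quotient are the intermediate values of the evaluation at \<open>l\<close>.
The quotient depends only on \<open>l\<close> and the coefficients, so one division in \<open>K\<close> serves all elements \<open>x\<close> of
the algebra, which need not commute with each other.
\<close>

lemma synthetic_division:
  assumes l: "l \<in> carrier K" and "set cs \<subseteq> carrier K" "c \<in> carrier K"
  shows "\<exists>qs. set qs \<subseteq> carrier K \<and> length qs = length cs \<and>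
    (\<forall>x\<in>carrier A. A.eval (map scalar (\<one>\<^bsub>K\<^esub> # cs @ [c])) x =
      (x \<ominus>\<^bsub>A\<^esub> scalar l) \<otimes>\<^bsub>A\<^esub> A.eval (map scalar (\<one>\<^bsub>K\<^esub> # qs)) x
        \<oplus>\<^bsub>A\<^esub> scalar (K.eval (\<one>\<^bsub>K\<^esub> # cs @ [c]) l))"
  using assms(2,3)
proof (induction cs arbitrary: c rule: rev_induct)
  case Nil
  have "A.eval (map scalar [\<one>\<^bsub>K\<^esub>, c]) x = (x \<ominus>\<^bsub>A\<^esub> scalar l) \<otimes>\<^bsub>A\<^esub> A.eval (map scalar [\<one>\<^bsub>K\<^esub>]) x
        \<oplus>\<^bsub>A\<^esub> scalar (K.eval [\<one>\<^bsub>K\<^esub>, c] l)" if x: "x \<in> carrier A" for x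
  proof -
    have "x \<oplus>\<^bsub>A\<^esub> scalar c = (x \<ominus>\<^bsub>A\<^esub> scalar l) \<oplus>\<^bsub>A\<^esub> (scalar l \<oplus>\<^bsub>A\<^esub> scalar c)"
      using x scalar_closed[OF l] scalar_closed[OF Nil(2)] by algebra
    then show ?thesis using x l Nil by (simp add: scalar_add)
  qed
  then show ?case by (intro exI[of _ "[]"]) simp
next
  case (snoc b cs)
  let ?p = "\<one>\<^bsub>K\<^esub> # cs @ [b]"
  have bc: "set cs \<subseteq> carrier K" "b \<in> carrier K" using snoc.prems by auto
  obtain qs where qs: "set qs \<subseteq> carrier K" "length qs = length cs"
    and IH: "\<And>x. x \<in> carrier A \<Longrightarrow> A.eval (map scalar ?p) x =
      (x \<ominus>\<^bsub>A\<^esub> scalar l) \<otimes>\<^bsub>A\<^esub> A.eval (map scalar (\<one>\<^bsub>K\<^esub> # qs)) x \<oplus>\<^bsub>A\<^esub> scalar (K.eval ?p l)"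
    using snoc.IH[OF bc] by blast
  define e where "e = K.eval ?p l"
  have e: "e \<in> carrier K" unfolding e_def using bc l by (intro K.eval_in_carrier) auto
  have ev: "K.eval (?p @ [c]) l = e \<otimes>\<^bsub>K\<^esub> l \<oplus>\<^bsub>K\<^esub> c"
    unfolding e_def using bc l snoc.prems by (intro K.eval_append_aux) auto
  have "A.eval (map scalar (?p @ [c])) x =
      (x \<ominus>\<^bsub>A\<^esub> scalar l) \<otimes>\<^bsub>A\<^esub> A.eval (map scalar (\<one>\<^bsub>K\<^esub> # qs @ [e])) x
        \<oplus>\<^bsub>A\<^esub> scalar (K.eval (?p @ [c]) l)" if x: "x \<in> carrier A" for x
  proof -
    define q where "q = A.eval (map scalar (\<one>\<^bsub>K\<^esub> # qs)) x"
    define sl se sc where "sl = scalar l" and "se = scalar e" and "sc = scalar c"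
    have q: "q \<in> carrier A" unfolding q_def using qs x by (intro A.eval_in_carrier) auto
    have s: "sl \<in> carrier A" "se \<in> carrier A" "sc \<in> carrier A"
      using l e snoc.prems by (simp_all add: sl_def se_def sc_def)
    have comm: "se \<otimes>\<^bsub>A\<^esub> x = x \<otimes>\<^bsub>A\<^esub> se" "se \<otimes>\<^bsub>A\<^esub> sl = sl \<otimes>\<^bsub>A\<^esub> se"
      using A.central_elem_commutes[OF scalar_central[OF e]] x s by (auto simp: se_def)
    have qe: "A.eval (map scalar ((\<one>\<^bsub>K\<^esub> # qs) @ [e])) x = q \<otimes>\<^bsub>A\<^esub> x \<oplus>\<^bsub>A\<^esub> se"
      unfolding q_def se_def map_append list.map(1,2) using qs x e
      by (intro A.eval_append_aux) auto
    have "A.eval (map scalar (?p @ [c])) x = A.eval (map scalar ?p) x \<otimes>\<^bsub>A\<^esub> x \<oplus>\<^bsub>A\<^esub> sc"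
      unfolding sc_def map_append[of _ ?p] list.map(1,2) using bc x snoc.prems
      by (intro A.eval_append_aux) auto
    also have "\<dots> = ((x \<ominus>\<^bsub>A\<^esub> sl) \<otimes>\<^bsub>A\<^esub> q \<oplus>\<^bsub>A\<^esub> se) \<otimes>\<^bsub>A\<^esub> x \<oplus>\<^bsub>A\<^esub> sc"
      unfolding IH[OF x] by (simp only: q_def sl_def se_def e_def)
    also have "\<dots> = (x \<ominus>\<^bsub>A\<^esub> sl) \<otimes>\<^bsub>A\<^esub> (q \<otimes>\<^bsub>A\<^esub> x) \<oplus>\<^bsub>A\<^esub> se \<otimes>\<^bsub>A\<^esub> x \<oplus>\<^bsub>A\<^esub> sc"
      using x q s by algebra
    also have "\<dots> = (x \<ominus>\<^bsub>A\<^esub> sl) \<otimes>\<^bsub>A\<^esub> (q \<otimes>\<^bsub>A\<^esub> x) \<oplus>\<^bsub>A\<^esub> x \<otimes>\<^bsub>A\<^esub> se \<oplus>\<^bsub>A\<^esub> sc"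
      by (simp only: comm)
    also have "\<dots> = (x \<ominus>\<^bsub>A\<^esub> sl) \<otimes>\<^bsub>A\<^esub> (q \<otimes>\<^bsub>A\<^esub> x \<oplus>\<^bsub>A\<^esub> se) \<oplus>\<^bsub>A\<^esub> (sl \<otimes>\<^bsub>A\<^esub> se \<oplus>\<^bsub>A\<^esub> sc)"
      using x q s by algebra
    also have "sl \<otimes>\<^bsub>A\<^esub> se \<oplus>\<^bsub>A\<^esub> sc = scalar (K.eval (?p @ [c]) l)"
      unfolding ev comm(2)[symmetric] using e l snoc.prems
      by (simp add: scalar_add scalar_mult sl_def se_def sc_def)
    finally show ?thesis using qe by (simp add: sl_def)
  qed
  then show ?case using qs e by (intro exI[of _ "qs @ [e]"]) simp
qed

lemma monic_eval_linear_factors: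
  assumes alg: "algebraically_closed K" and "set cs \<subseteq> carrier K"
  shows "\<exists>ls. set ls \<subseteq> carrier K \<and>
    (\<forall>x\<in>carrier A. A.eval (map scalar (\<one>\<^bsub>K\<^esub> # cs)) x = A.linear_factors x (map scalar ls))"
  using assms(2)
proof (induction "length cs" arbitrary: cs)
  case 0
  then show ?case by (intro exI[of _ "[]"]) simp
next
  case (Suc n)
  then obtain ds c where cs: "cs = ds @ [c]" by (metis length_Suc_conv list.distinct(1) rev_exhaust)
  interpret alg: algebraically_closed K by (rule alg)
  have "\<one>\<^bsub>K\<^esub> # cs \<in> carrier (poly_ring K)"
    using Suc.prems by (simp add: univ_poly_carrier[symmetric] polynomial_def)
  then obtain l where l: "l \<in> carrier K" "K.eval (\<one>\<^bsub>K\<^esub> # cs) l = \<zero>\<^bsub>K\<^esub>"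
    using alg.root_exists[of "\<one>\<^bsub>K\<^esub> # cs"] cs by auto
  obtain qs where qs: "set qs \<subseteq> carrier K" "length qs = length ds"
    and div: "\<forall>x\<in>carrier A. A.eval (map scalar (\<one>\<^bsub>K\<^esub> # cs)) x =
      (x \<ominus>\<^bsub>A\<^esub> scalar l) \<otimes>\<^bsub>A\<^esub> A.eval (map scalar (\<one>\<^bsub>K\<^esub> # qs)) x
        \<oplus>\<^bsub>A\<^esub> scalar (K.eval (\<one>\<^bsub>K\<^esub> # cs) l)"
    using synthetic_division[OF l(1), of ds c] Suc.prems cs by auto
  obtain ls where ls: "set ls \<subseteq> carrier K"
    "\<forall>x\<in>carrier A. A.eval (map scalar (\<one>\<^bsub>K\<^esub> # qs)) x = A.linear_factors x (map scalar ls)"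
    using Suc.hyps(1)[of qs] Suc.hyps(2) qs cs by auto
  have "A.eval (map scalar (\<one>\<^bsub>K\<^esub> # cs)) x = A.linear_factors x (map scalar (l # ls))"
    if x: "x \<in> carrier A" for x
  proof -
    have "A.linear_factors x (map scalar ls) \<in> carrier A"
      using x ls(1) by (intro A.linear_factors_closed) auto
    moreover have "A.eval (map scalar (\<one>\<^bsub>K\<^esub> # cs)) x =
      (x \<ominus>\<^bsub>A\<^esub> scalar l) \<otimes>\<^bsub>A\<^esub> A.linear_factors x (map scalar ls) \<oplus>\<^bsub>A\<^esub> scalar \<zero>\<^bsub>K\<^esub>"
      using div ls(2) x l(2) by metis
    ultimately show ?thesis using x l(1) by simp
  qed
  then show ?case using l ls by (intro exI[of _ "l # ls"]) auto
qed

lemma u_pow: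
  assumes g: "g \<in> carrier G"
  shows "\<exists>k\<in>carrier K. u g [^]\<^bsub>A\<^esub> (n::nat) = k \<odot>\<^bsub>A\<^esub> u (g [^]\<^bsub>G\<^esub> n)"
proof (induction n)
  case 0
  then show ?case by (intro bexI[of _ "\<one>\<^bsub>K\<^esub>"]) (simp_all add: u_one)
next
  case (Suc n)
  then obtain k where k: "k \<in> carrier K" "u g [^]\<^bsub>A\<^esub> n = k \<odot>\<^bsub>A\<^esub> u (g [^]\<^bsub>G\<^esub> n)" by blast
  then have "u g [^]\<^bsub>A\<^esub> Suc n = (k \<otimes>\<^bsub>K\<^esub> \<rho> (g [^]\<^bsub>G\<^esub> n) g) \<odot>\<^bsub>A\<^esub> u (g [^]\<^bsub>G\<^esub> Suc n)"
    using g by (simp add: smult_mult_left basis_mult factor_closed smult_assoc1)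
  then show ?case using k g factor_closed by blast
qed

text \<open>A power of \<open>u g\<close> is a scalar \<open>k\<close>, so the factorization of \<open>X^n - k\<close> over \<open>K\<close> annihilates \<open>u g\<close>.\<close>

lemma u_splits_over_scalars:
  assumes alg: "algebraically_closed K"
    and idc: "\<And>e. A.idempotent e \<Longrightarrow> central_elem A e"
    and g: "g \<in> carrier G" and n: "n > 0" "g [^]\<^bsub>G\<^esub> (n::nat) = \<one>\<^bsub>G\<^esub>"
  shows "A.splits_over scalars (u g)"
proof -
  obtain k where k: "k \<in> carrier K" "u g [^]\<^bsub>A\<^esub> n = scalar k"
    using u_pow[OF g, of n] n by (auto simp: u_one scalar_def)
  let ?cs = "replicate (n - 1) \<zero>\<^bsub>K\<^esub> @ [\<ominus>\<^bsub>K\<^esub> k]"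
  have cs: "set ?cs \<subseteq> carrier K" using k by auto
  obtain ls where ls_closed: "set ls \<subseteq> carrier K"
    and ls_eval: "\<forall>x\<in>carrier A. A.eval (map scalar (\<one>\<^bsub>K\<^esub> # ?cs)) x = A.linear_factors x (map scalar ls)"
    using monic_eval_linear_factors[OF alg cs] by (elim exE conjE) (rule that)
  note ls = ls_closed bspec[OF ls_eval u_closed[OF g]]
  have p: "map scalar (\<one>\<^bsub>K\<^esub> # ?cs) = A.monom \<one>\<^bsub>A\<^esub> (n - 1) @ [\<ominus>\<^bsub>A\<^esub> scalar k]"
    using k by (simp add: A.monom_def scalar_uminus)
  have "A.linear_factors (u g) (map scalar ls) =
      A.eval (A.monom \<one>\<^bsub>A\<^esub> (n - 1) @ [\<ominus>\<^bsub>A\<^esub> scalar k]) (u g)"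
    by (simp only: ls(2)[symmetric] p)
  also have "\<dots> = A.eval (A.monom \<one>\<^bsub>A\<^esub> (n - 1)) (u g) \<otimes>\<^bsub>A\<^esub> u g \<oplus>\<^bsub>A\<^esub> \<ominus>\<^bsub>A\<^esub> scalar k"
    using g k by (intro A.eval_append_aux A.monom_in_carrier) auto
  also have "A.eval (A.monom \<one>\<^bsub>A\<^esub> (n - 1)) (u g) \<otimes>\<^bsub>A\<^esub> u g = u g [^]\<^bsub>A\<^esub> Suc (n - 1)"
    using g by (simp add: A.eval_monom)
  also have "\<dots> = scalar k" using n k by simp
  finally have "A.linear_factors (u g) (map scalar ls) = \<zero>\<^bsub>A\<^esub>" using k by (simp add: M.r_neg)
  then show ?thesis
    using ls g by (intro A.splits_over_if_linear_factors_zero[OF idc, where L = "map scalar ls"])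
      (auto intro: scalar_central scalar_diff_unit)
qed

text \<open>
The two sides are nonzero multiples of \<open>u (g h)\<close> and \<open>u (h g)\<close>; independence identifies first the group
elements, then the coefficients.
\<close>

lemma symmetric_if_u_commute:
  assumes g: "g \<in> carrier G" and h: "h \<in> carrier G"
    and comm: "u g \<otimes>\<^bsub>A\<^esub> u h = u h \<otimes>\<^bsub>A\<^esub> u g"
  shows "g \<otimes>\<^bsub>G\<^esub> h = h \<otimes>\<^bsub>G\<^esub> g" "\<rho> g h = \<rho> h g"
proof -
  have r: "represents (\<lambda>x. if x = g \<otimes>\<^bsub>G\<^esub> h then \<rho> g h else \<zero>\<^bsub>K\<^esub>) (u g \<otimes>\<^bsub>A\<^esub> u h)"
    using represents_basis g h by (simp add: basis_mult factor_closed)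
  have r': "represents (\<lambda>x. if x = h \<otimes>\<^bsub>G\<^esub> g then \<rho> h g else \<zero>\<^bsub>K\<^esub>) (u g \<otimes>\<^bsub>A\<^esub> u h)"
    unfolding comm using represents_basis g h by (simp add: basis_mult factor_closed)
  have "\<rho> g h = (if g \<otimes>\<^bsub>G\<^esub> h = h \<otimes>\<^bsub>G\<^esub> g then \<rho> h g else \<zero>\<^bsub>K\<^esub>)"
    using represents_unique[OF r r', of "g \<otimes>\<^bsub>G\<^esub> h"] g h by simp
  then show "g \<otimes>\<^bsub>G\<^esub> h = h \<otimes>\<^bsub>G\<^esub> g" "\<rho> g h = \<rho> h g"
    using factor_nonzero[OF g h] by (auto split: if_splits)
qed

lemma cring_if_comm_symmetric:
  assumes comm: "comm_group G" and sym: "symmetric_factor_system G \<rho>"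
  shows "cring A"
proof -
  have uu: "u g \<otimes>\<^bsub>A\<^esub> u h = u h \<otimes>\<^bsub>A\<^esub> u g" if g: "g \<in> carrier G" and h: "h \<in> carrier G" for g h
  proof -
    have "g \<otimes>\<^bsub>G\<^esub> h = h \<otimes>\<^bsub>G\<^esub> g" using comm g h by (simp add: comm_group_def comm_monoid.m_comm)
    then show ?thesis using sym g h by (simp add: basis_mult symmetric_factor_system_def)
  qed
  have ux: "x \<otimes>\<^bsub>A\<^esub> u g = u g \<otimes>\<^bsub>A\<^esub> x" if g: "g \<in> carrier G" and "x \<in> carrier A" for g x
    using that(2)
  proof (induction x rule: induct_basis)
    case (basis k h)
    then show ?case using g uu by (simp add: smult_mult_left smult_mult_right)
  qed (use g in \<open>simp_all add: A.l_distr A.r_distr\<close>)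
  have "x \<otimes>\<^bsub>A\<^esub> y = y \<otimes>\<^bsub>A\<^esub> x" if "x \<in> carrier A" "y \<in> carrier A" for x y
    using that(2)
  proof (induction y rule: induct_basis)
    case (basis k h)
    then show ?case using that(1) ux by (simp add: smult_mult_left smult_mult_right)
  qed (use that(1) in \<open>simp_all add: A.l_distr A.r_distr\<close>)
  then show ?thesis
    by (intro cring.intro A.ring_axioms comm_monoid.intro A.monoid_axioms comm_monoid_axioms.intro)
qed

section \<open>The characterization\<close>

lemma comm_torsion_symmetric_if_xiN:
  assumes alg: "algebraically_closed K" and xi: "xiN_ring A"
  shows "comm_group G \<and> torsion_group G \<and> symmetric_factor_system G \<rho>"
proof -
  have nil: "central_elem A x" if "nilpotent_elem A x" for x
    using that A.nilpotents_central[OF xi] unfolding nilpotent_elem_def by blast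
  have idc: "central_elem A e" if "A.idempotent e" for e
  proof (rule A.idempotents_central[OF _ that])
    fix x assume "x \<in> carrier A" "x \<otimes>\<^bsub>A\<^esub> x = \<zero>\<^bsub>A\<^esub>"
    then have "x [^]\<^bsub>A\<^esub> (2::nat) = \<zero>\<^bsub>A\<^esub>" by (simp add: numeral_2_eq_2)
    then show "central_elem A x" using A.nilpotents_central[OF xi] \<open>x \<in> carrier A\<close> by blast
  qed
  have "central_elem A (u g)" if g: "g \<in> carrier G" for g
  proof -
    obtain n :: nat where n: "n > 0" "g [^]\<^bsub>G\<^esub> n = \<one>\<^bsub>G\<^esub>" using torsion_if_xiN[OF xi g] by blast
    show ?thesis
      by (rule A.central_if_splits_over[OF idc nil _ _ u_splits_over_scalars[OF alg idc g n]])
         (use g scalar_central in auto)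
  qed
  then have comm: "u g \<otimes>\<^bsub>A\<^esub> u h = u h \<otimes>\<^bsub>A\<^esub> u g" if "g \<in> carrier G" "h \<in> carrier G" for g h
    using A.central_elem_commutes that by simp
  have "comm_group G"
    by (rule G.group_comm_groupI) (use symmetric_if_u_commute(1)[OF _ _ comm] in blast)
  moreover have "torsion_group G"
    using torsion_if_xiN[OF xi] G.group_axioms by (simp add: torsion_group_def)
  moreover have "symmetric_factor_system G \<rho>"
    using symmetric_if_u_commute(2)[OF _ _ comm] by (simp add: symmetric_factor_system_def)
  ultimately show ?thesis by blast
qed

lemma xiN_if_comm_torsion_symmetric:
  assumes alg: "algebraically_closed K" and comm: "comm_group G" and torsion: "torsion_group G"
    and sym: "symmetric_factor_system G \<rho>"
  shows "xiN_ring A"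
proof -
  interpret AC: cring A by (rule cring_if_comm_symmetric[OF comm sym])
  have central: "central_elem A x" if "x \<in> carrier A" for x
    using that AC.m_comm by (simp add: central_elem_def)
  have splits: "A.splits_over scalars x" if "x \<in> carrier A" for x
    using that
  proof (induction x rule: induct_basis)
    case zero
    have "\<zero>\<^bsub>A\<^esub> \<in> scalars" by (rule image_eqI[of _ _ "\<zero>\<^bsub>K\<^esub>"]) simp_all
    then show ?case by (rule AC.splits_over_in[OF _ scalars_subset])
  next
    case (basis k g)
    obtain n :: nat where n: "n > 0" "g [^]\<^bsub>G\<^esub> n = \<one>\<^bsub>G\<^esub>"
      using torsion basis unfolding torsion_group_def by blast
    have "A.splits_over scalars (u g)"
      by (rule u_splits_over_scalars[OF alg _ basis(2) n]) (simp add: central A.idempotent_def)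
    moreover have "scalar k \<otimes>\<^bsub>A\<^esub> l \<in> scalars" if "l \<in> scalars" for l
      using that basis by (auto simp flip: scalar_mult)
    ultimately have "A.splits_over scalars (scalar k \<otimes>\<^bsub>A\<^esub> u g)"
      using basis by (intro AC.splits_over_smult[OF scalars_subset]) auto
    then show ?case using basis by (simp add: smult_eq_scalar_mult)
  next
    case (add x y)
    have "l \<oplus>\<^bsub>A\<^esub> m \<in> scalars" if "l \<in> scalars" "m \<in> scalars" for l m
      using that by (auto simp flip: scalar_add)
    then show ?case using add by (intro AC.splits_over_add[OF scalars_subset]) auto
  qed
  show ?thesis
    unfolding xiN_ring_def
  proof (intro conjI ballI A.ring_axioms)
    fix a assume a: "a \<in> carrier A"
    let ?z = "\<lambda>b. a [^]\<^bsub>A\<^esub> (2::nat) \<otimes>\<^bsub>A\<^esub> b \<ominus>\<^bsub>A\<^esub> a"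
    have "l = \<zero>\<^bsub>A\<^esub> \<or> l \<in> Units A" if "l \<in> scalars" for l
      using that scalar_unit by force
    then have "\<exists>b\<in>carrier A. nilpotent_elem A (?z b)"
      by (rule AC.quasi_inverse_if_splits_over[OF scalars_subset _ a splits[OF a]])
    then obtain b where b: "b \<in> carrier A" "nilpotent_elem A (?z b)" by (elim bexE)
    have "central_elem A (?z b)" by (rule central) (use a b in simp)
    then show "\<exists>b\<in>carrier A. central_elem A (?z b) \<and> nilpotent_elem A (?z b)"
      using b by (intro bexI[of _ b] conjI)
  qed
qed

end

theorem theorem5:
  fixes K :: "('k, 'x) ring_scheme"
    and G :: "('g, 'y) monoid_scheme"
    and \<rho> :: "'g \<Rightarrow> 'g \<Rightarrow> 'k"
    and A :: "('k, 'a, 'z) module_scheme"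
    and u :: "'g \<Rightarrow> 'a"
  assumes "algebraically_closed K"
    and "group G"
    and "twisted_group_algebra K G \<rho> A u"
  shows "xiN_ring A \<longleftrightarrow>
    (comm_group G \<and> torsion_group G) \<and> symmetric_factor_system G \<rho>"
  using twisted_group_algebra.comm_torsion_symmetric_if_xiN[OF assms(3,1)]
    twisted_group_algebra.xiN_if_comm_torsion_symmetric[OF assms(3,1)]
  by blast

end
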